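(* Let $T$ and $S$ be rational tangles. Then $T$ and $S$ are isotopic if and only if they have the same fraction, i.e. $F(T)=F(S)$ in $\mathbb{Q}\cup\{\infty\}$.
   Context: A $2$-tangle is a proper embedding of two unoriented arcs and finitely many circles in a $3$-ball $B^3$, with the four arc endpoints on $\partial B^3$; it is represented by a diagram in a disc with the four endpoints at the positions NW, NE, SW, SE. Two tangles are isotopic ($T\sim S$) if there is an orientation-preserving self-homeomorphism of $B^3$ carrying one to the other and equal to the identity on the boundary; equivalently, their diagrams have the same endpoint configuration and are related by Reidemeister moves inside the disc. Elementary tangles: $[0]$ consists of two uncrossed arcs joining NW to NE and SW to SE; $[\infty]$ consists of two uncrossed arcs joining NW to SW and NE to SE; $[+1]$ is the single-crossing tangle whose overcrossing strand joins NW to SE, and $[-1]$ is the single-crossing tangle with the other choice of crossing. The sum $T+S$ is obtained by placing $S$ to the right of $T$ and joining NE, SE of $T$ to NW, SW of $S$; the product $T*S$ is obtained by placing $S$ below $T$ and joining SW, SE of $T$ to NW, NE of $S$. A rational tangle is a $2$-tangle consisting of two arcs $\alpha_1,\alpha_2$ such that $(B^3,\alpha_1,\alpha_2)$ is homeomorphic, as a pair, to $(D^2\times I,\{x,y\}\times I)$. Equivalently, up to isotopy it has a diagram in twist form: one obtained from $[0]$ or $[\infty]$ by finitely many consecutive operations $T\mapsto T+[\pm1]$, $T\mapsto[\pm1]+T$, $T\mapsto T*[\pm1]$, $T\mapsto[\pm1]*T$. The fraction of a rational tangle is computed from a twist form diagram of it by $F([0])=0$, $F([\infty])=\infty=\frac10$,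 $F(T+[\pm1])=F([\pm1]+T)=F(T)\pm1$, and $F(T*[\pm1])=F([\pm1]*T)=\dfrac{1}{\pm1+\frac{1}{F(T)}}$, with the conventions $\frac10=\infty$, $\frac1\infty=0$, $\infty\pm1=\infty$. Equivalently, in the algebraic expression of the twist form each integer tangle is replaced by the corresponding integer and $*$ is replaced by the operation $x*y=\frac{1}{\frac1x+\frac1y}$. The assertion is that equality of fractions, computed from any twist form diagrams of $T$ and $S$, is equivalent to isotopy of $T$ and $S$. *)

theory Defs
  imports Main "HOL.Rat"
begin

text \<open>
  A diagram in the disc, put in general position with respect to the height function, is cut by
  horizontal lines into slices, each of which contains exactly one local maximum, one local minimum
  or one crossing, all other strands in the slice being vertical. Diagrams are read from top to
  bottom, and the strands meeting a horizontal line are numbered \<open>0, 1, 2, \<dots>\<close> from left to right.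
  The slice \<open>(i, s)\<close> has exactly \<open>i\<close> vertical strands to the left of the feature \<open>s\<close>:

  \<^item> \<open>(i, Cap)\<close>: a local maximum; two new strands \<open>i\<close> and \<open>i + 1\<close> start below it;
  \<^item> \<open>(i, Cup)\<close>: a local minimum; the strands \<open>i\<close> and \<open>i + 1\<close> coming from above are joined;
  \<^item> \<open>(i, Cross b)\<close>: the strands \<open>i\<close> and \<open>i + 1\<close> cross; if \<open>b\<close> holds, the overcrossing strand is the
    one running from upper left to lower right, otherwise it is the one running from upper right to
    lower left.
\<close>

datatype feature = Cap | Cup | Cross bool

type_synonym diagram = "(nat \<times> feature) list"

fun strands_above :: "feature \<Rightarrow> nat" where
  "strands_above Cap = 0"
| "strands_above Cup = 2"
| "strands_above (Cross b) = 2"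

fun strands_below :: "feature \<Rightarrow> nat" where
  "strands_below Cap = 2"
| "strands_below Cup = 0"
| "strands_below (Cross b) = 2"

text \<open>\<open>diagram_from_to m D n\<close>: started with \<open>m\<close> strands at the top, \<open>D\<close> ends with \<open>n\<close> strands at
  the bottom, and every feature finds the strands it needs.\<close>

fun diagram_from_to :: "nat \<Rightarrow> diagram \<Rightarrow> nat \<Rightarrow> bool" where
  "diagram_from_to m [] n \<longleftrightarrow> m = n"
| "diagram_from_to m ((i, s) # D) n \<longleftrightarrow>
     i + strands_above s \<le> m \<and> diagram_from_to (m - strands_above s + strands_below s) D n"

text \<open>The two top strands of a 2-tangle end at NW and NE, the two bottom strands at SW and SE. Such a
  diagram has exactly four ends on the boundary, so it consists of two arcs and finitely many
  closed curves.\<close>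

definition tangle_diagram :: "diagram \<Rightarrow> bool" where
  "tangle_diagram D \<longleftrightarrow> diagram_from_to 2 D 2"

text \<open>Local moves. The first five rules generate planar isotopy, that is, they describe how the slice
  decomposition changes while the diagram is deformed in the disc: exchanging the heights of
  two features lying side by side, creating or cancelling a maximum and a minimum on a strand, and
  moving a strand of a crossing through a maximum or minimum of the other strand (this rotates the
  crossing, so the same overcrossing strand is described by the opposite Boolean). The
  remaining rules are the Reidemeister moves. In \<open>R3\<close> the strands \<open>1, 2, 3\<close> (numbered at the top)
  cross pairwise, \<open>a\<close>, \<open>b\<close>, \<open>c\<close> telling whether \<open>1\<close> is above \<open>2\<close>, \<open>1\<close> above \<open>3\<close>, \<open>2\<close> above \<open>3\<close>;
  the side condition excludes exactly the two cyclic choices.\<close>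

inductive local_move :: "diagram \<Rightarrow> diagram \<Rightarrow> bool" where
  exchange: "i \<le> j \<Longrightarrow>
     local_move [(i, s), (j + strands_below s, t)] [(j + strands_above s, t), (i, s)]"
| zigzag_left: "local_move [(i, Cap), (i + 1, Cup)] []"
| zigzag_right: "local_move [(i + 1, Cap), (i, Cup)] []"
| slide_Cap: "local_move [(i, Cap), (i + 1, Cross b)] [(i + 1, Cap), (i, Cross (\<not> b))]"
| slide_Cup: "local_move [(i + 1, Cross b), (i, Cup)] [(i, Cross (\<not> b)), (i + 1, Cup)]"
| R1_Cap: "local_move [(i, Cap), (i, Cross b)] [(i, Cap)]"
| R1_Cup: "local_move [(i, Cross b), (i, Cup)] [(i, Cup)]"
| R2: "local_move [(i, Cross b), (i, Cross (\<not> b))] []"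
| R3: "b = a \<or> b = c \<Longrightarrow>
     local_move [(i, Cross a), (i + 1, Cross b), (i, Cross c)]
                [(i + 1, Cross c), (i, Cross b), (i + 1, Cross a)]"

text \<open>One move, in either direction, inside a 2-tangle diagram. Since both sides have to be
  2-tangle diagrams, a move can only be performed where its strands are present.\<close>

inductive tangle_move :: "diagram \<Rightarrow> diagram \<Rightarrow> bool" where
  "local_move D E \<or> local_move E D \<Longrightarrow>
   tangle_diagram (U @ D @ V) \<Longrightarrow> tangle_diagram (U @ E @ V) \<Longrightarrow>
   tangle_move (U @ D @ V) (U @ E @ V)"

definition isotopic :: "diagram \<Rightarrow> diagram \<Rightarrow> bool" (infix "\<sim>" 50) where
  "T \<sim> S \<longleftrightarrow> tangle_diagram T \<and> tangle_diagram S \<and> tangle_move\<^sup>*\<^sup>* T S"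

definition zero_tangle :: diagram where
  "zero_tangle = [(0, Cup), (0, Cap)]"

definition infinity_tangle :: diagram where
  "infinity_tangle = []"

text \<open>\<open>unit_tangle True\<close> is [+1] and \<open>unit_tangle False\<close> is [-1].\<close>

definition unit_tangle :: "bool \<Rightarrow> diagram" where
  "unit_tangle b = [(0, Cross b)]"

definition shift_right :: "nat \<Rightarrow> diagram \<Rightarrow> diagram" where
  "shift_right k D = map (\<lambda>(i, s). (i + k, s)) D"

text \<open>The maximum joins NE of \<open>T\<close> to NW of \<open>S\<close> and the minimum joins SE of \<open>T\<close> to SW of \<open>S\<close>; in
  between \<open>S\<close>, drawn lower, stands to the right of the two strands of \<open>T\<close>.\<close>

definition tangle_sum :: "diagram \<Rightarrow> diagram \<Rightarrow> diagram" where
  "tangle_sum T S = [(1, Cap)] @ T @ shift_right 2 S @ [(1, Cup)]"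

definition tangle_product :: "diagram \<Rightarrow> diagram \<Rightarrow> diagram" where
  "tangle_product T S = T @ S"

text \<open>Twist forms; the Boolean is the sign of the crossing, as in \<open>unit_tangle\<close>.\<close>

datatype twist_form =
    Zero
  | Infinity
  | Add_Right twist_form bool
  | Add_Left bool twist_form
  | Mult_Bottom twist_form bool
  | Mult_Top bool twist_form

primrec twist_diagram :: "twist_form \<Rightarrow> diagram" where
  "twist_diagram Zero = zero_tangle"
| "twist_diagram Infinity = infinity_tangle"
| "twist_diagram (Add_Right t b) = tangle_sum (twist_diagram t) (unit_tangle b)"
| "twist_diagram (Add_Left b t) = tangle_sum (unit_tangle b) (twist_diagram t)"
| "twist_diagram (Mult_Bottom t b) = tangle_product (twist_diagram t) (unit_tangle b)"
| "twist_diagram (Mult_Top b t) = tangle_product (unit_tangle b) (twist_diagram t)"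

text \<open>The rationals with one point at infinity, which is \<open>None\<close>.\<close>

type_synonym ext_rat = "rat option"

definition ext_add :: "ext_rat \<Rightarrow> rat \<Rightarrow> ext_rat" where
  "ext_add x r = map_option (\<lambda>q. q + r) x"

fun ext_inverse :: "ext_rat \<Rightarrow> ext_rat" where
  "ext_inverse None = Some 0"
| "ext_inverse (Some q) = (if q = 0 then None else Some (1 / q))"

definition crossing_sign :: "bool \<Rightarrow> rat" where
  "crossing_sign b = (if b then 1 else - 1)"

primrec twist_fraction :: "twist_form \<Rightarrow> ext_rat" where
  "twist_fraction Zero = Some 0"
| "twist_fraction Infinity = None"
| "twist_fraction (Add_Right t b) = ext_add (twist_fraction t) (crossing_sign b)"
| "twist_fraction (Add_Left b t) = ext_add (twist_fraction t) (crossing_sign b)"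
| "twist_fraction (Mult_Bottom t b) =
     ext_inverse (ext_add (ext_inverse (twist_fraction t)) (crossing_sign b))"
| "twist_fraction (Mult_Top b t) =
     ext_inverse (ext_add (ext_inverse (twist_fraction t)) (crossing_sign b))"

definition rational_tangle :: "diagram \<Rightarrow> bool" where
  "rational_tangle T \<longleftrightarrow> (\<exists>t. T \<sim> twist_diagram t)"

text \<open>\<open>has_fraction T q\<close>: some twist form of \<open>T\<close> has fraction \<open>q\<close>. This is a relation because
  independence of the chosen twist form is not part of the definition of the fraction.\<close>

definition has_fraction :: "diagram \<Rightarrow> ext_rat \<Rightarrow> bool" where
  "has_fraction T q \<longleftrightarrow> (\<exists>t. T \<sim> twist_diagram t \<and> twist_fraction t = q)"

end

theory Submission
  imports Defs
begin

text \<open>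
  That isotopic tangles have equal fractions is seen from colourings of the strands by rationals
  with \<open>2 \<cdot> over = under + under'\<close> at each crossing: they are invariant under all moves, and a
  rational tangle with top colours \<open>a, b\<close> and bottom colours \<open>c, d\<close> is colourable iff
  \<open>a + d = b + c\<close> and \<open>(b - a) / (a - c)\<close> is its fraction.

  Conversely, bending the ends of a tangle downwards turns the operations \<open>T + [\<plusminus>1]\<close>, \<open>[\<plusminus>1] + T\<close>
  and \<open>T * [\<plusminus>1]\<close> into crossings of four parallel strands, so that they define an action of the
  braid group \<open>B\<^sub>4\<close> on isotopy classes; bending differently, so do \<open>T * [\<plusminus>1]\<close>, \<open>T + [\<plusminus>1]\<close> and
  \<open>[\<plusminus>1] * T\<close>. The kernel of \<open>B\<^sub>4 \<rightarrow> B\<^sub>3\<close>, \<open>\<sigma>\<^sub>1, \<sigma>\<^sub>3 \<mapsto> \<sigma>\<^sub>1\<close>, is generated by two elements, both of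
  which fix \<open>[\<infinity>]\<close>; being normal, it acts trivially on the orbit of \<open>[\<infinity>]\<close>, which gives the flypes
  \<open>[\<plusminus>1] + T \<sim> T + [\<plusminus>1]\<close> and \<open>[\<plusminus>1] * T \<sim> T * [\<plusminus>1]\<close> for rational \<open>T\<close>. It remains to move each element
  of the \<open>B\<^sub>3\<close>-orbit of \<open>[\<infinity>]\<close> to the continued fraction form determined by its fraction; the only
  cases that are not immediate are handled by the half twist \<open>\<Delta> = \<sigma>\<^sub>1 \<sigma>\<^sub>2 \<sigma>\<^sub>1\<close>, which interchanges
  the generators and acts on fractions as \<open>x \<mapsto> -1/x\<close>.
\<close>

section \<open>Isotopy of diagrams with arbitrary numbers of ends\<close>

text \<open>Bending produces diagrams with no upper and four lower ends, so isotopy is set up for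
  all numbers of ends; with two ends on either side it is \<open>tangle_move\<close> again.\<close>

inductive slice_move :: "nat \<Rightarrow> nat \<Rightarrow> diagram \<Rightarrow> diagram \<Rightarrow> bool" for m n where
  "local_move D E \<or> local_move E D \<Longrightarrow>
   diagram_from_to m (U @ D @ V) n \<Longrightarrow> diagram_from_to m (U @ E @ V) n \<Longrightarrow>
   slice_move m n (U @ D @ V) (U @ E @ V)"

definition slice_iso :: "nat \<Rightarrow> nat \<Rightarrow> diagram \<Rightarrow> diagram \<Rightarrow> bool" where
  "slice_iso m n D E \<longleftrightarrow> diagram_from_to m D n \<and> diagram_from_to m E n \<and> (slice_move m n)\<^sup>*\<^sup>* D E"

lemma shift_right_simps [simp]:
  "shift_right k [] = []"
  "shift_right k ((i, s) # D) = (i + k, s) # shift_right k D"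
  "shift_right k (D @ E) = shift_right k D @ shift_right k E"
  "shift_right 0 D = D"
  "shift_right k (shift_right l D) = shift_right (k + l) D"
  by (auto simp: shift_right_def)

lemma diagram_append:
  "diagram_from_to m (U @ V) n \<longleftrightarrow> (\<exists>k. diagram_from_to m U k \<and> diagram_from_to k V n)"
  by (induction m U n arbitrary: V rule: diagram_from_to.induct) auto

lemma diagram_unique: "diagram_from_to m D n \<Longrightarrow> diagram_from_to m D n' \<Longrightarrow> n = n'"
  by (induction m D n rule: diagram_from_to.induct) auto

lemma diagram_append_eq:
  "diagram_from_to m U k \<Longrightarrow> diagram_from_to m (U @ V) n \<longleftrightarrow> diagram_from_to k V n"
  using diagram_append diagram_unique by blast

lemma diagram_widen: "diagram_from_to m D n \<Longrightarrow> diagram_from_to (m + k) D (n + k)"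
proof (induction m D n rule: diagram_from_to.induct)
  case (2 m i s D n)
  have eq: "m + k - strands_above s + strands_below s = m - strands_above s + strands_below s + k"
    using 2(2) by simp
  have "diagram_from_to (m - strands_above s + strands_below s) D n" using 2(2) by (simp only: diagram_from_to.simps)
  from 2(1)[OF this] 2(2) show ?case
    by (auto simp only: diagram_from_to.simps eq shift_right_simps)
qed simp

lemma diagram_shift: "diagram_from_to m D n \<Longrightarrow> diagram_from_to (m + k) (shift_right k D) (n + k)"
proof (induction m D n rule: diagram_from_to.induct)
  case (2 m i s D n)
  have eq: "m + k - strands_above s + strands_below s = m - strands_above s + strands_below s + k"
    using 2(2) by simp
  have "diagram_from_to (m - strands_above s + strands_below s) D n" using 2(2) by (simp only: diagram_from_to.simps)
  from 2(1)[OF this] 2(2) show ?case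
    by (auto simp only: diagram_from_to.simps eq shift_right_simps)
qed simp

lemma local_move_shift: "local_move D E \<Longrightarrow> local_move (shift_right k D) (shift_right k E)"
proof (induction rule: local_move.induct)
  case (exchange i j s t)
  then show ?case
    using local_move.exchange[of "i + k" "j + k" s t] by (simp add: ac_simps)
qed (use local_move.intros in \<open>auto simp: ac_simps\<close>)

lemma slice_iso_refl: "diagram_from_to m D n \<Longrightarrow> slice_iso m n D D"
  by (simp add: slice_iso_def)

lemma slice_move_sym: "slice_move m n D E \<Longrightarrow> slice_move m n E D"
  by (auto elim!: slice_move.cases intro: slice_move.intros)

lemma slice_iso_sym: "slice_iso m n D E \<Longrightarrow> slice_iso m n E D"
  unfolding slice_iso_def by (metis slice_move_sym sympD sympI symp_rtranclp)

lemma slice_iso_trans [trans]: "slice_iso m n D E \<Longrightarrow> slice_iso m n E F \<Longrightarrow> slice_iso m n D F"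
  unfolding slice_iso_def by auto

lemma slice_iso_map:
  assumes "slice_iso m n D E"
    and "\<And>D. diagram_from_to m D n \<Longrightarrow> diagram_from_to m' (f D) n'"
    and "\<And>D E. slice_move m n D E \<Longrightarrow> slice_move m' n' (f D) (f E)"
  shows "slice_iso m' n' (f D) (f E)"
proof -
  have "(slice_move m' n')\<^sup>*\<^sup>* (f D) (f E)" if "(slice_move m n)\<^sup>*\<^sup>* D E"
    using that by induction (auto intro: rtranclp.rtrancl_into_rtrancl assms(3))
  with assms show ?thesis by (simp add: slice_iso_def)
qed

lemma slice_iso_context:
  assumes "slice_iso k l D E" "diagram_from_to m U k" "diagram_from_to l V n"
  shows "slice_iso m n (U @ D @ V) (U @ E @ V)"
proof (rule slice_iso_map[OF assms(1)])
  fix D assume "diagram_from_to k D l"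
  with assms show "diagram_from_to m (U @ D @ V) n" by (auto simp: diagram_append)
next
  fix D E assume "slice_move k l D E"
  then show "slice_move m n (U @ D @ V) (U @ E @ V)"
  proof cases
    case (1 D' E' U' V')
    then have "slice_move m n ((U @ U') @ D' @ V' @ V) ((U @ U') @ E' @ V' @ V)"
      using assms(2,3) by (intro slice_move.intros) (auto simp: diagram_append)
    with 1 show ?thesis by simp
  qed
qed

lemma slice_iso_widen: 
  assumes "slice_iso m n D E" shows "slice_iso (m + k) (n + k) D E"
  using assms
  by (rule slice_iso_map[where f = "\<lambda>D. D"])
    (auto elim!: slice_move.cases intro!: slice_move.intros diagram_widen)

lemma slice_iso_shift: 
  assumes "slice_iso m n D E" shows "slice_iso (m + k) (n + k) (shift_right k D) (shift_right k E)"
  using assms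
proof (rule slice_iso_map)
  fix D E assume "slice_move m n D E"
  then show "slice_move (m + k) (n + k) (shift_right k D) (shift_right k E)"
  proof cases
    case (1 D' E' U' V')
    then show ?thesis
      using diagram_shift[of m _ n k] local_move_shift[of _ _ k]
      by (metis shift_right_simps(3) slice_move.intros)
  qed
qed (rule diagram_shift)

lemma slice_iso_local:
  assumes "local_move D E" "diagram_from_to m (U @ D @ V) n" "diagram_from_to m (U @ E @ V) n"
  shows "slice_iso m n (U @ D @ V) (U @ E @ V)"
  using assms by (auto simp: slice_iso_def intro!: r_into_rtranclp slice_move.intros)

lemma slice_move_2_2: "slice_move 2 2 = tangle_move"
  by (intro ext) (auto simp: tangle_diagram_def elim!: slice_move.cases tangle_move.cases
    intro: slice_move.intros tangle_move.intros)

lemma isotopic_iff_iso: "T \<sim> S \<longleftrightarrow> slice_iso 2 2 T S"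
  by (simp add: isotopic_def slice_iso_def tangle_diagram_def slice_move_2_2)

section \<open>Exchanging the heights of blocks that stand side by side\<close>

lemma interchange_slice:
  assumes "i + strands_above s \<le> m" "diagram_from_to k D l" "n = m - strands_above s + strands_below s"
  shows "slice_iso (m + k) (n + l) ((i, s) # shift_right n D) (shift_right m D @ [(i, s)])"
  using assms(2)
proof (induction k D l rule: diagram_from_to.induct)
  case (1 k l)
  with assms show ?case by (auto intro!: slice_iso_refl)
next
  case (2 k j t D l)
  let ?k = "k - strands_above t + strands_below t"
  have *: "diagram_from_to ?k D l" using 2(2) by (simp only: diagram_from_to.simps)
  \<comment> \<open>\<open>p\<close> counts the strands left of \<open>t\<close> without those
    attached to \<open>s\<close>, which is the form that \<open>exchange\<close> asks for.\<close>
  define p where "p = j + (m - strands_above s)"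
  have p: "j + n = p + strands_below s" "j + m = p + strands_above s" "i \<le> p"
    using assms by (auto simp: p_def)
  have "slice_iso (m + k) (n + l) ([] @ [(i, s), (j + n, t)] @ shift_right n D)
     ([] @ [(j + m, t), (i, s)] @ shift_right n D)"
    unfolding p
  proof (rule slice_iso_local[OF exchange], fact)
    have "diagram_from_to (n + ?k) (shift_right n D) (n + l)"
      using diagram_shift[OF *, of n] by (simp only: add.commute)
    moreover have "m + k - strands_above s + strands_below s - strands_above t + strands_below t = n + ?k"
      "m + k - strands_above t + strands_below t - strands_above s + strands_below s = n + ?k"
      using 2 assms by auto
    ultimately show "diagram_from_to (m + k) ([] @ [(i, s), (p + strands_below s, t)] @ shift_right n D) (n + l)"
      "diagram_from_to (m + k) ([] @ [(p + strands_above s, t), (i, s)] @ shift_right n D) (n + l)"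
      using 2 assms unfolding p_def by auto
  qed
  also have "slice_iso (m + k) (n + l) ([] @ [(j + m, t), (i, s)] @ shift_right n D)
    ([(j + m, t)] @ (shift_right m D @ [(i, s)]) @ [])"
    using slice_iso_context[OF 2(1)[OF *], where U = "[(j + m, t)]" and V = "[]" and m = "m + k" and n = "n + l"]
      2 by simp
  finally show ?case by simp
qed

text \<open>The slices of \<open>E\<close> pass \<open>D\<close> one at a time by
  \<open>interchange_slice\<close>. \<open>D\<close> is shifted by \<open>n\<close> when it stands
  lower than \<open>E\<close> and by \<open>m\<close> when it stands higher.\<close>

lemma interchange:
  assumes "diagram_from_to m E n" "diagram_from_to k D l"
  shows "slice_iso (m + k) (n + l) (E @ shift_right n D) (shift_right m D @ E)"
  using assms(1)
proof (induction m E n rule: diagram_from_to.induct)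
  case (1 m n)
  then show ?case
    using diagram_shift[OF assms(2), of m] by (auto intro!: slice_iso_refl simp: add.commute)
next
  case (2 m i s E n)
  let ?m = "m - strands_above s + strands_below s"
  have "slice_iso (m + k) (n + l) ([(i, s)] @ (E @ shift_right n D) @ []) ([(i, s)] @ (shift_right ?m D @ E) @ [])"
    by (rule slice_iso_context[where k = "?m + k" and l = "n + l"]) (use 2 in auto)
  also have "slice_iso (m + k) (n + l) ([(i, s)] @ (shift_right ?m D @ E) @ [])
    ([] @ (shift_right m D @ [(i, s)]) @ E)"
  proof -
    have E: "diagram_from_to (?m + l) E (n + l)"
      using 2(2) by (intro diagram_widen) (simp only: diagram_from_to.simps)
    have "slice_iso (m + k) (?m + l) ((i, s) # shift_right ?m D) (shift_right m D @ [(i, s)])"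
      using 2(2) assms(2) by (intro interchange_slice) auto
    from slice_iso_context[OF this _ E, of "m + k" "[]"] show ?thesis by simp
  qed
  finally show ?case by simp
qed

section \<open>Bending the ends of a tangle\<close>

abbreviation add_right :: "bool \<Rightarrow> diagram \<Rightarrow> diagram" where
  "add_right s T \<equiv> tangle_sum T (unit_tangle s)"

abbreviation add_left :: "bool \<Rightarrow> diagram \<Rightarrow> diagram" where
  "add_left s T \<equiv> tangle_sum (unit_tangle s) T"

abbreviation mult_bottom :: "bool \<Rightarrow> diagram \<Rightarrow> diagram" where
  "mult_bottom s T \<equiv> tangle_product T (unit_tangle s)"

abbreviation mult_top :: "bool \<Rightarrow> diagram \<Rightarrow> diagram" where
  "mult_top s T \<equiv> tangle_product (unit_tangle s) T"

lemma Suc_Suc_0 [simp]: "Suc (Suc 0) = 2"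
  by simp

lemmas tangle_ops = tangle_sum_def tangle_product_def unit_tangle_def

text \<open>From left to right the four lower ends are NW, SW, SE, NE in \<open>bend_apart T\<close> and
  SW, SE, NE, NW in \<open>bend_right T\<close>.\<close>

definition bend_apart :: "diagram \<Rightarrow> diagram" where
  "bend_apart T = [(0, Cap), (2, Cap)] @ shift_right 1 T"

definition bend_right :: "diagram \<Rightarrow> diagram" where
  "bend_right T = [(0, Cap), (1, Cap)] @ T"

lemma tangle_widths:
  assumes "tangle_diagram T"
  shows "diagram_from_to 2 T 2" "diagram_from_to 4 T 4" "diagram_from_to 6 T 6"
    "diagram_from_to 3 (shift_right 1 T) 3" "diagram_from_to 4 (shift_right 1 T) 4"
    "diagram_from_to 6 (shift_right 1 T) 6"
    "diagram_from_to 4 (shift_right 2 T) 4" "diagram_from_to 6 (shift_right 2 T) 6"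
    "diagram_from_to 6 (shift_right 3 T) 6"
  using assms diagram_widen[of 2 T 2 2] diagram_widen[of 2 T 2 4] diagram_shift[of 2 T 2 1]
   diagram_widen[OF diagram_shift[of 2 T 2 1], of 1] diagram_widen[OF diagram_shift[of 2 T 2 1], of 3]
   diagram_shift[of 2 T 2 2] diagram_widen[OF diagram_shift[of 2 T 2 2], of 2]
   diagram_widen[OF diagram_shift[of 2 T 2 3], of 1]
  by (simp_all add: tangle_diagram_def)

lemma tangle_append:
  assumes "tangle_diagram T"
  shows "diagram_from_to 2 (T @ V) n \<longleftrightarrow> diagram_from_to 2 V n"
    "diagram_from_to 4 (T @ V) n \<longleftrightarrow> diagram_from_to 4 V n"
    "diagram_from_to 6 (T @ V) n \<longleftrightarrow> diagram_from_to 6 V n"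
    "diagram_from_to 3 (shift_right (Suc 0) T @ V) n \<longleftrightarrow> diagram_from_to 3 V n"
    "diagram_from_to 4 (shift_right (Suc 0) T @ V) n \<longleftrightarrow> diagram_from_to 4 V n"
    "diagram_from_to 6 (shift_right (Suc 0) T @ V) n \<longleftrightarrow> diagram_from_to 6 V n"
    "diagram_from_to 4 (shift_right 2 T @ V) n \<longleftrightarrow> diagram_from_to 4 V n"
    "diagram_from_to 6 (shift_right 2 T @ V) n \<longleftrightarrow> diagram_from_to 6 V n"
    "diagram_from_to 6 (shift_right 3 T @ V) n \<longleftrightarrow> diagram_from_to 6 V n"
  using tangle_widths[OF assms] by (simp_all add: diagram_append_eq)

lemmas tangle_valid = tangle_append tangle_widths[unfolded One_nat_def]

lemma tangle_diagram_ops: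
  assumes "tangle_diagram T"
  shows "tangle_diagram (add_right s T)" "tangle_diagram (add_left s T)"
    "tangle_diagram (mult_bottom s T)" "tangle_diagram (mult_top s T)"
  using tangle_valid[OF assms] by (simp_all add: tangle_diagram_def tangle_ops)

lemma bend_valid:
  assumes "tangle_diagram T"
  shows "diagram_from_to 0 (bend_apart T) 4" "diagram_from_to 0 (bend_right T) 4"
  using tangle_valid[OF assms] by (simp_all add: bend_apart_def bend_right_def)

text \<open>Bending can be undone: two outer strands are added, minima join them to the ends NW and
  NE, and the bends cancel as zigzags.\<close>

lemma bend_apart_inject:
  assumes "tangle_diagram T" "tangle_diagram S" "slice_iso 0 4 (bend_apart T) (bend_apart S)"
  shows "T \<sim> S"
proof -
  have straighten: "slice_iso 2 2 (shift_right 1 (bend_apart T) @ [(0, Cup), (2, Cup)]) T"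
    if T: "tangle_diagram T" for T
  proof -
    note v = tangle_valid[OF T]
    have "slice_iso 2 2 ([(1, Cap), (3, Cap)] @ (shift_right 2 T @ [(0, Cup)]) @ [(2, Cup)])
      ([(1, Cap), (3, Cap)] @ ([(0, Cup)] @ T) @ [(2, Cup)])"
      by (rule slice_iso_context[OF slice_iso_widen[OF slice_iso_sym, of 4 2 _ _ 2]])
        (use interchange[of 2 "[(0, Cup)]" 0 2 T 2] v in simp_all)
    also have "slice_iso 2 2 ([(1, Cap), (3, Cap)] @ ([(0, Cup)] @ T) @ [(2, Cup)])
      ([(1, Cap)] @ [(0, Cup), (1, Cap)] @ T @ [(2, Cup)])"
      using slice_iso_local[OF exchange[of 0 1 Cup Cap], of 2 "[(1, Cap)]" "T @ [(2, Cup)]" 2, THEN slice_iso_sym] v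
      by simp
    also have "slice_iso 2 2 ([(1, Cap)] @ [(0, Cup), (1, Cap)] @ T @ [(2, Cup)])
      ([(1, Cap)] @ T @ [(2, Cup)])"
      using slice_iso_local[OF zigzag_right[of 0], of 2 "[]" "(1, Cap) # T @ [(2, Cup)]" 2] v
      by simp
    also have "slice_iso 2 2 \<dots> ([(1, Cap)] @ ([(2, Cup)] @ T) @ [])"
      using slice_iso_context[OF interchange[of 2 T 2 2 "[(0, Cup)]" 0], of 2 "[(1, Cap)]" "[]" 2] v
      by simp
    also have "slice_iso 2 2 ([(1, Cap)] @ ([(2, Cup)] @ T) @ []) T"
      using slice_iso_local[OF zigzag_left[of 1], of 2 "[]" T 2] v
      by simp
    finally show ?thesis by (simp add: bend_apart_def)
  qed
  have "slice_iso 2 2 ([] @ shift_right 1 (bend_apart T) @ [(0, Cup), (2, Cup)])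
    ([] @ shift_right 1 (bend_apart S) @ [(0, Cup), (2, Cup)])"
    by (rule slice_iso_context[of 2 6]) (use slice_iso_widen[OF slice_iso_shift[OF assms(3), of 1], of 1] in simp_all)
  with straighten[OF assms(1)] straighten[OF assms(2)] show ?thesis
    unfolding isotopic_iff_iso by (metis append_Nil slice_iso_sym slice_iso_trans)
qed

text \<open>Here both bends run to the right, so two nested minima with two strands added on the
  right undo them.\<close>

lemma bend_right_inject:
  assumes "tangle_diagram T" "tangle_diagram S" "slice_iso 0 4 (bend_right T) (bend_right S)"
  shows "T \<sim> S"
proof -
  have straighten: "slice_iso 2 2 (bend_right T @ [(3, Cup), (2, Cup)]) T"
    if T: "tangle_diagram T" for T
  proof -
    note v = tangle_valid[OF T]
    have "slice_iso 2 2 ([(0, Cap), (1, Cap)] @ (T @ [(3, Cup), (2, Cup)]) @ [])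
      ([(0, Cap), (1, Cap)] @ ([(3, Cup), (2, Cup)] @ T) @ [])"
      by (rule slice_iso_context[of 6 2])
        (use interchange[of 2 T 2 4 "[(1, Cup), (0, Cup)]" 0] v in simp_all)
    also have "slice_iso 2 2 ([(0, Cap), (1, Cap)] @ ([(3, Cup), (2, Cup)] @ T) @ [])
      ([(0, Cap)] @ [(1, Cup), (1, Cap)] @ [(2, Cup)] @ T)"
      using slice_iso_local[OF exchange[of 1 1 Cap Cup], of 2 "[(0, Cap)]" "(2, Cup) # T" 2] v
      by simp
    also have "slice_iso 2 2 ([(0, Cap)] @ [(1, Cup), (1, Cap)] @ [(2, Cup)] @ T)
      ([(1, Cap), (2, Cup)] @ T)"
      using slice_iso_local[OF zigzag_left[of 0], of 2 "[]" "[(1, Cap), (2, Cup)] @ T" 2] v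
      by simp
    also have "slice_iso 2 2 ([(1, Cap), (2, Cup)] @ T) T"
      using slice_iso_local[OF zigzag_left[of 1], of 2 "[]" T 2] v
      by simp
    finally show ?thesis by (simp add: bend_right_def)
  qed
  have "slice_iso 2 2 ([] @ bend_right T @ [(3, Cup), (2, Cup)])
    ([] @ bend_right S @ [(3, Cup), (2, Cup)])"
    by (rule slice_iso_context[of 2 6]) (use slice_iso_widen[OF assms(3), of 2] in simp_all)
  with straighten[OF assms(1)] straighten[OF assms(2)] show ?thesis
    unfolding isotopic_iff_iso by (metis append_Nil slice_iso_sym slice_iso_trans)
qed

text \<open>The maximum of the bend is lowered past \<open>T\<close>, the crossing slides through
  it, which rotates the crossing by a quarter turn, and the maximum then cancels against the minimum
  of the sum. Different \<open>k\<close> serve the two ways of bending.\<close>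

lemma slide_twist_right:
  assumes "diagram_from_to (k + 2) T (k + 2)"
  shows "slice_iso k (k + 2) ([(k, Cap), (k, Cap)] @ T @ [(k + 1, Cross s), (k, Cup)])
    ([(k, Cap)] @ T @ [(k, Cross (\<not> s))])"
proof -
  have T4: "diagram_from_to (k + 4) T (k + 4)"
    using diagram_widen[OF assms, of 2] by (simp add: numeral_eq_Suc del: Suc_Suc_0)
  have v: "diagram_from_to (Suc (Suc k)) (T @ V) n = diagram_from_to (Suc (Suc k)) V n"
    "diagram_from_to (Suc (Suc (Suc (Suc k)))) (T @ V) n = diagram_from_to (Suc (Suc (Suc (Suc k)))) V n"
    for V n
    using diagram_append_eq[OF assms] diagram_append_eq[OF T4] by (simp_all add: numeral_eq_Suc del: Suc_Suc_0)
  note v = v[folded numeral_2_eq_2] v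
  have "slice_iso k (k + 2) ([(k, Cap), (k, Cap)] @ T @ [(k + 1, Cross s), (k, Cup)])
    ([(k, Cap)] @ ([(k + 2, Cap)] @ T) @ [(k + 1, Cross s), (k, Cup)])"
    using slice_iso_local[OF exchange[of k k Cap Cap], of k "[]" "T @ [(k + 1, Cross s), (k, Cup)]" "k + 2", THEN slice_iso_sym]
    by (simp add: v numeral_eq_Suc del: Suc_Suc_0)
  also have "slice_iso k (k + 2) \<dots> ([(k, Cap)] @ (T @ [(k + 2, Cap)]) @ [(k + 1, Cross s), (k, Cup)])"
    by (rule slice_iso_context[of "k + 2" "k + 4", OF slice_iso_sym])
      (use interchange[OF assms, of 0 "[(0, Cap)]" 2] in \<open>simp_all add: numeral_eq_Suc del: Suc_Suc_0\<close>)
  also have "slice_iso k (k + 2) ([(k, Cap)] @ (T @ [(k + 2, Cap)]) @ [(k + 1, Cross s), (k, Cup)])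
    (([(k, Cap)] @ T) @ [(k + 1, Cap), (k + 2, Cross (\<not> s))] @ [(k, Cup)])"
    using slice_iso_local[OF slide_Cap[of "k + 1" "\<not> s"], of k "[(k, Cap)] @ T" "[(k, Cup)]" "k + 2", THEN slice_iso_sym]
    by (simp add: v numeral_eq_Suc del: Suc_Suc_0)
  also have "slice_iso k (k + 2) \<dots> (([(k, Cap)] @ T @ [(k + 1, Cap)]) @ [(k, Cup), (k, Cross (\<not> s))] @ [])"
    using slice_iso_local[OF exchange[of k k Cup "Cross (\<not> s)"], of k "[(k, Cap)] @ T @ [(k + 1, Cap)]" "[]" "k + 2", THEN slice_iso_sym]
    by (simp add: v numeral_eq_Suc del: Suc_Suc_0)
  also have "slice_iso k (k + 2) \<dots> (([(k, Cap)] @ T) @ [] @ [(k, Cross (\<not> s))])"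
    using slice_iso_local[OF zigzag_right[of k], of k "[(k, Cap)] @ T" "[(k, Cross (\<not> s))]" "k + 2"]
    by (simp add: v numeral_eq_Suc del: Suc_Suc_0)
  finally show ?thesis by simp
qed

lemma bend_apart_add_right:
  assumes "tangle_diagram T"
  shows "slice_iso 0 4 (bend_apart (add_right s T)) (bend_apart T @ [(2, Cross (\<not> s))])"
proof -
  note v = tangle_valid[OF assms]
  have "slice_iso 0 4 ([(0, Cap)] @ ([(2, Cap), (2, Cap)] @ shift_right 1 T @ [(2 + 1, Cross s), (2, Cup)]) @ [])
    ([(0, Cap)] @ ([(2, Cap)] @ shift_right 1 T @ [(2, Cross (\<not> s))]) @ [])"
    by (rule slice_iso_context[OF slide_twist_right]) (use v in simp_all)
  then show ?thesis by (simp add: bend_apart_def tangle_ops)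
qed

lemma bend_right_add_right:
  assumes "tangle_diagram T"
  shows "slice_iso 0 4 (bend_right (add_right s T)) (bend_right T @ [(1, Cross (\<not> s))])"
proof -
  note v = tangle_valid[OF assms]
  have "slice_iso 0 4 ([(0, Cap)] @ ([(1, Cap), (1, Cap)] @ T @ [(1 + 1, Cross s), (1, Cup)]) @ [])
    ([(0, Cap)] @ ([(1, Cap)] @ T @ [(1, Cross (\<not> s))]) @ [])"
    by (rule slice_iso_context[OF slice_iso_widen[OF slide_twist_right, of _ _ 1]])
      (use diagram_widen[of 2 T 2 1] assms in \<open>simp_all add: tangle_diagram_def\<close>)
  then show ?thesis by (simp add: bend_right_def tangle_ops)
qed

lemma bend_mult_bottom:
  "bend_apart (mult_bottom s T) = bend_apart T @ [(1, Cross s)]"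
  "bend_right (mult_bottom s T) = bend_right T @ [(0, Cross s)]"
  by (simp_all add: bend_apart_def bend_right_def tangle_ops)

text \<open>Mirror image of the right summand, except that the crossing starts above
  \<open>T\<close>: it slides through a maximum, sinks below \<open>T\<close>, and the leftover
  zigzag is straightened.\<close>

lemma bend_apart_add_left:
  assumes "tangle_diagram T"
  shows "slice_iso 0 4 (bend_apart (add_left s T)) (bend_apart T @ [(0, Cross (\<not> s))])"
proof -
  note v = tangle_valid[OF assms]
  have "slice_iso 0 4 ([] @ [(0, Cap), (2, Cap)] @ [(2, Cap), (1, Cross s)] @ shift_right 3 T @ [(2, Cup)])
    ([(0, Cap)] @ [(0, Cap), (2, Cap)] @ [(1, Cross s)] @ shift_right 3 T @ [(2, Cup)])"
    using slice_iso_local[OF exchange[of 0 0 Cap Cap], of 0 "[]" "[(2, Cap), (1, Cross s)] @ shift_right 3 T @ [(2, Cup)]" 4] v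
    by simp
  also have "slice_iso 0 4 \<dots> 
    ([(0, Cap), (0, Cap)] @ [(0, Cap), (1, Cross s)] @ shift_right 3 T @ [(2, Cup)])"
    using slice_iso_local[OF exchange[of 0 0 Cap Cap], of 0 "[(0, Cap)]" "[(1, Cross s)] @ shift_right 3 T @ [(2, Cup)]" 4] v
    by simp
  also have "slice_iso 0 4 \<dots> 
    ([(0, Cap), (0, Cap)] @ [(1, Cap), (0, Cross (\<not> s))] @ shift_right 3 T @ [(2, Cup)])"
    using slice_iso_local[OF slide_Cap[of 0 s], of 0 "[(0, Cap), (0, Cap)]" "shift_right 3 T @ [(2, Cup)]" 4] v
    by simp
  also have "slice_iso 0 4 \<dots> 
    ([(0, Cap), (0, Cap), (1, Cap)] @ ((shift_right 3 T @ [(2, Cup)]) @ [(0, Cross (\<not> s))]) @ [])"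
  proof -
    have "diagram_from_to 4 (shift_right 1 T @ [(0, Cup)]) 2"
      using v by simp
    from slice_iso_context[OF interchange[of 2 "[(0, Cross (\<not> s))]" 2, OF _ this], of 0 "[(0, Cap), (0, Cap), (1, Cap)]" "[]" 4]
    show ?thesis by simp
  qed
  also have "slice_iso 0 4 \<dots>
    ([(0, Cap), (0, Cap)] @ (shift_right 1 T @ [(1, Cap)]) @ [(2, Cup), (0, Cross (\<not> s))])"
    using slice_iso_context[OF slice_iso_widen[OF interchange[of 1 "[(1, Cap)]" 3 2 T 2], of 1], of 0 "[(0, Cap), (0, Cap)]" "[(2, Cup), (0, Cross (\<not> s))]" 4] v
    by simp
  also have "slice_iso 0 4 \<dots>
    (([(0, Cap), (0, Cap)] @ shift_right 1 T) @ [] @ [(0, Cross (\<not> s))])"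
    using slice_iso_local[OF zigzag_left[of 1], of 0 "[(0, Cap), (0, Cap)] @ shift_right 1 T" "[(0, Cross (\<not> s))]" 4] v
    by simp
  also have "slice_iso 0 4 \<dots>
    ([] @ [(0, Cap), (2, Cap)] @ shift_right 1 T @ [(0, Cross (\<not> s))])"
    using slice_iso_local[OF exchange[of 0 0 Cap Cap], of 0 "[]" "shift_right 1 T @ [(0, Cross (\<not> s))]" 4, THEN slice_iso_sym] v
    by simp
  finally show ?thesis by (simp add: bend_apart_def tangle_ops)
qed

text \<open>The crossing slides through both bends in turn. Each slide reverses the Boolean, so it
  arrives unchanged at the free ends NE, NW and can sink past \<open>T\<close>.\<close>

lemma bend_right_mult_top:
  assumes "tangle_diagram T"
  shows "slice_iso 0 4 (bend_right (mult_top s T)) (bend_right T @ [(2, Cross s)])"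
proof -
  note v = tangle_valid[OF assms]
  have "slice_iso 0 4 ([(0, Cap)] @ [(1, Cap), (0, Cross s)] @ T)
    ([(0, Cap)] @ [(0, Cap), (1, Cross (\<not> s))] @ T)"
    using slice_iso_local[OF slide_Cap[of 0 "\<not> s"], of 0 "[(0, Cap)]" T 4, THEN slice_iso_sym] v by simp
  also have "slice_iso 0 4 \<dots> ([] @ [(0, Cap), (2, Cap)] @ [(1, Cross (\<not> s))] @ T)"
    using slice_iso_local[OF exchange[of 0 0 Cap Cap], of 0 "[]" "[(1, Cross (\<not> s))] @ T" 4, THEN slice_iso_sym] v
    by simp
  also have "slice_iso 0 4 \<dots> ([(0, Cap)] @ [(1, Cap), (2, Cross s)] @ T)"
    using slice_iso_local[OF slide_Cap[of 1 s], of 0 "[(0, Cap)]" T 4, THEN slice_iso_sym] v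
    by simp
  also have "slice_iso 0 4 \<dots> ([(0, Cap), (1, Cap)] @ (T @ [(2, Cross s)]) @ [])"
    using slice_iso_context[OF slice_iso_sym[OF interchange[of 2 T 2 2 "[(0, Cross s)]" 2]], of 0 "[(0, Cap), (1, Cap)]" "[]" 4] v
    by simp
  finally show ?thesis by (simp add: bend_right_def tangle_ops)
qed

section \<open>Twists of isotopy classes of tangles\<close>

lemma plat_braid:
  assumes "diagram_from_to 0 P 4" "i \<le> 1"
  shows "slice_iso 0 4 (P @ [(i, Cross s), (i + 1, Cross s), (i, Cross s)])
    (P @ [(i + 1, Cross s), (i, Cross s), (i + 1, Cross s)])"
  using slice_iso_local[OF R3[of s s s i], of 0 P "[]" 4] assms by (simp add: diagram_append_eq)

lemma plat_commute:
  assumes "diagram_from_to 0 P 4"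
  shows "slice_iso 0 4 (P @ [(0, Cross s), (2, Cross t)]) (P @ [(2, Cross t), (0, Cross s)])"
  using slice_iso_local[OF exchange[of 0 0 "Cross s" "Cross t"], of 0 P "[]" 4] assms
  by (simp add: diagram_append_eq)

lemma plat_cancel:
  assumes "diagram_from_to 0 P 4" "i \<le> 2"
  shows "slice_iso 0 4 (P @ [(i, Cross s), (i, Cross (\<not> s))]) P"
  using slice_iso_local[OF R2[of i s], of 0 P "[]" 4] assms by (simp add: diagram_append_eq)

text \<open>\<open>P\<close> may be any isotopic form of the bent tangle, so that a composite of
  tangle operations is read off as a braid word appended to \<open>P\<close>.\<close>

definition bent :: "(diagram \<Rightarrow> diagram) \<Rightarrow> diagram \<Rightarrow> diagram \<Rightarrow> bool" where
  "bent f T P \<longleftrightarrow> tangle_diagram T \<and> slice_iso 0 4 (f T) P"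

lemma bent_self:
  assumes "tangle_diagram T"
  shows "bent bend_apart T (bend_apart T)" "bent bend_right T (bend_right T)"
  using bend_valid[OF assms] assms by (simp_all add: bent_def slice_iso_refl)

lemma bent_isotopic:
  assumes "bent f T P" "bent f S Q" "slice_iso 0 4 P Q" "f = bend_apart \<or> f = bend_right"
  shows "T \<sim> S"
  using assms unfolding bent_def
  by (metis bend_apart_inject bend_right_inject slice_iso_sym slice_iso_trans)

lemma bent_append:
  assumes "bent f T P" "tangle_diagram S" "slice_iso 0 4 (f S) (f T @ [(i, Cross s)])" "i \<le> 2"
  shows "bent f S (P @ [(i, Cross s)])"
proof -
  have "slice_iso 0 4 ([] @ f T @ [(i, Cross s)]) ([] @ P @ [(i, Cross s)])"
    by (rule slice_iso_context[of 0 4]) (use assms in \<open>auto simp: bent_def\<close>)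
  with assms show ?thesis unfolding bent_def by (auto intro: slice_iso_trans)
qed

text \<open>Sums reverse the Boolean because their crossing slides through one bend; the bottom
  product appends its crossing as it stands.\<close>

lemma bent_apart_ops:
  assumes "bent bend_apart T P"
  shows "bent bend_apart (add_right s T) (P @ [(2, Cross (\<not> s))])"
    "bent bend_apart (add_left s T) (P @ [(0, Cross (\<not> s))])"
    "bent bend_apart (mult_bottom s T) (P @ [(1, Cross s)])"
proof -
  have T: "tangle_diagram T" using assms by (simp add: bent_def)
  note ops = tangle_diagram_ops[OF T]
  show "bent bend_apart (add_right s T) (P @ [(2, Cross (\<not> s))])"
    by (rule bent_append[OF assms ops(1) bend_apart_add_right[OF T]]) simp
  show "bent bend_apart (add_left s T) (P @ [(0, Cross (\<not> s))])"
    by (rule bent_append[OF assms ops(2) bend_apart_add_left[OF T]]) simp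
  show "bent bend_apart (mult_bottom s T) (P @ [(1, Cross s)])"
    by (rule bent_append[OF assms ops(3)])
      (use bend_valid(1)[OF ops(3), of s] in \<open>simp_all add: bend_mult_bottom slice_iso_refl\<close>)
qed

lemma bent_right_ops:
  assumes "bent bend_right T P"
  shows "bent bend_right (add_right s T) (P @ [(1, Cross (\<not> s))])"
    "bent bend_right (mult_bottom s T) (P @ [(0, Cross s)])"
    "bent bend_right (mult_top s T) (P @ [(2, Cross s)])"
proof -
  have T: "tangle_diagram T" using assms by (simp add: bent_def)
  note ops = tangle_diagram_ops[OF T]
  show "bent bend_right (add_right s T) (P @ [(1, Cross (\<not> s))])"
    by (rule bent_append[OF assms ops(1) bend_right_add_right[OF T]]) simp
  show "bent bend_right (mult_top s T) (P @ [(2, Cross s)])"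
    by (rule bent_append[OF assms ops(4) bend_right_mult_top[OF T]]) simp
  show "bent bend_right (mult_bottom s T) (P @ [(0, Cross s)])"
    by (rule bent_append[OF assms ops(3)])
      (use bend_valid(2)[OF ops(3), of s] in \<open>simp_all add: bend_mult_bottom slice_iso_refl\<close>)
qed

section \<open>The quotient by isotopy and the twists acting on it\<close>

lemma isotopic_refl: "tangle_diagram T \<Longrightarrow> T \<sim> T"
  by (simp add: isotopic_def)

lemma isotopic_sym: "T \<sim> S \<Longrightarrow> S \<sim> T"
  unfolding isotopic_iff_iso by (rule slice_iso_sym)

lemma isotopic_trans: "T \<sim> S \<Longrightarrow> S \<sim> R \<Longrightarrow> T \<sim> R"
  unfolding isotopic_iff_iso by (rule slice_iso_trans)

lemma isotopic_ops:
  assumes "T \<sim> S"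
  shows "add_right s T \<sim> add_right s S" "add_left s T \<sim> add_left s S"
    "mult_bottom s T \<sim> mult_bottom s S" "mult_top s T \<sim> mult_top s S"
proof -
  have iso: "slice_iso 2 2 T S" using assms by (simp add: isotopic_iff_iso)
  have "slice_iso 2 2 ([(1, Cap)] @ T @ [(2, Cross s), (1, Cup)]) ([(1, Cap)] @ S @ [(2, Cross s), (1, Cup)])"
    by (rule slice_iso_context[of 4 4]) (use slice_iso_widen[OF iso, of 2] in simp_all)
  then show "add_right s T \<sim> add_right s S"
    by (simp add: isotopic_iff_iso tangle_ops)
  have "slice_iso 2 2 ([(1, Cap), (0, Cross s)] @ shift_right 2 T @ [(1, Cup)])
    ([(1, Cap), (0, Cross s)] @ shift_right 2 S @ [(1, Cup)])"
    by (rule slice_iso_context[of 4 4]) (use slice_iso_shift[OF iso, of 2] in simp_all)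
  then show "add_left s T \<sim> add_left s S"
    by (simp add: isotopic_iff_iso tangle_ops)
  have "slice_iso 2 2 ([] @ T @ [(0, Cross s)]) ([] @ S @ [(0, Cross s)])"
    by (rule slice_iso_context[OF iso]) simp_all
  then show "mult_bottom s T \<sim> mult_bottom s S"
    by (simp add: isotopic_iff_iso tangle_ops)
  have "slice_iso 2 2 ([(0, Cross s)] @ T @ []) ([(0, Cross s)] @ S @ [])"
    by (rule slice_iso_context[OF iso]) simp_all
  then show "mult_top s T \<sim> mult_top s S"
    by (simp add: isotopic_iff_iso tangle_ops)
qed

\<comment> \<open>Isotopy is reflexive only on tangle diagrams, hence a partial quotient. In it
  isotopies become equations, so composites of twists can be rewritten.\<close>
quotient_type tangle = diagram / partial: isotopic
proof (rule part_equivpI)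
  show "\<exists>x. x \<sim> x" 
    using isotopic_refl[of infinity_tangle] by (auto simp: tangle_diagram_def infinity_tangle_def)
  show "symp (\<sim>)" by (auto intro: sympI isotopic_sym)
  show "transp (\<sim>)" by (auto intro: transpI isotopic_trans)
qed

lift_definition right_twist :: "bool \<Rightarrow> tangle \<Rightarrow> tangle" is "add_right"
  by (rule isotopic_ops)

lift_definition left_twist :: "bool \<Rightarrow> tangle \<Rightarrow> tangle" is "add_left"
  by (rule isotopic_ops)

lift_definition bottom_twist :: "bool \<Rightarrow> tangle \<Rightarrow> tangle" is "mult_bottom"
  by (rule isotopic_ops)

lift_definition top_twist :: "bool \<Rightarrow> tangle \<Rightarrow> tangle" is "mult_top"
  by (rule isotopic_ops)

lemma tangle_diagram_elementary: "tangle_diagram zero_tangle" "tangle_diagram infinity_tangle"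
  by (simp_all add: tangle_diagram_def zero_tangle_def infinity_tangle_def)

lift_definition zero :: tangle is zero_tangle
  by (rule isotopic_refl, rule tangle_diagram_elementary)

lift_definition infinity :: tangle is infinity_tangle
  by (rule isotopic_refl, rule tangle_diagram_elementary)

lemma isotopic_valid: "T \<sim> S \<Longrightarrow> tangle_diagram T"
  by (simp add: isotopic_def)

text \<open>Bending puts the two crossings one below the other on the same two strands, where they
  cancel by Reidemeister II.\<close>

lemma twist_inverse [simp]:
  "right_twist s (right_twist (\<not> s) X) = X"
  "right_twist (\<not> s) (right_twist s X) = X"
  "left_twist s (left_twist (\<not> s) X) = X"
  "left_twist (\<not> s) (left_twist s X) = X"
  "bottom_twist s (bottom_twist (\<not> s) X) = X"
  "bottom_twist (\<not> s) (bottom_twist s X) = X"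
  "top_twist s (top_twist (\<not> s) X) = X"
  "top_twist (\<not> s) (top_twist s X) = X"
proof -
  have right: "right_twist s (right_twist (\<not> s) X) = X" for s X
  proof (transfer, drule isotopic_valid)
    fix s T assume T: "tangle_diagram T"
    show "add_right s (add_right (\<not> s) T) \<sim> T"
      by (rule bent_isotopic[OF bent_apart_ops(1)[OF bent_apart_ops(1)] _ _ disjI1[OF refl]])
        (use bent_self(1)[OF T] plat_cancel[OF bend_valid(1)[OF T], of 2] in auto)
  qed
  have left: "left_twist s (left_twist (\<not> s) X) = X" for s X
  proof (transfer, drule isotopic_valid)
    fix s T assume T: "tangle_diagram T"
    show "add_left s (add_left (\<not> s) T) \<sim> T"
      by (rule bent_isotopic[OF bent_apart_ops(2)[OF bent_apart_ops(2)] _ _ disjI1[OF refl]])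
        (use bent_self(1)[OF T] plat_cancel[OF bend_valid(1)[OF T], of 0] in auto)
  qed
  have bottom: "bottom_twist s (bottom_twist (\<not> s) X) = X" for s X
  proof (transfer, drule isotopic_valid)
    fix s T assume T: "tangle_diagram T"
    show "mult_bottom s (mult_bottom (\<not> s) T) \<sim> T"
      by (rule bent_isotopic[OF bent_apart_ops(3)[OF bent_apart_ops(3)] _ _ disjI1[OF refl]])
        (use bent_self(1)[OF T] plat_cancel[OF bend_valid(1)[OF T], of 1 "\<not> s"] in auto)
  qed
  have top: "top_twist s (top_twist (\<not> s) X) = X" for s X
  proof (transfer, drule isotopic_valid)
    fix s T assume T: "tangle_diagram T"
    show "mult_top s (mult_top (\<not> s) T) \<sim> T"
      by (rule bent_isotopic[OF bent_right_ops(3)[OF bent_right_ops(3)] _ _ disjI2[OF refl]])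
        (use bent_self(2)[OF T] plat_cancel[OF bend_valid(2)[OF T], of 2 "\<not> s"] in auto)
  qed
  show "right_twist s (right_twist (\<not> s) X) = X"
    "right_twist (\<not> s) (right_twist s X) = X"
    "left_twist s (left_twist (\<not> s) X) = X"
    "left_twist (\<not> s) (left_twist s X) = X"
    "bottom_twist s (bottom_twist (\<not> s) X) = X"
    "bottom_twist (\<not> s) (bottom_twist s X) = X"
    "top_twist s (top_twist (\<not> s) X) = X"
    "top_twist (\<not> s) (top_twist s X) = X"
    using right[of "\<not> s" X] left[of "\<not> s" X] bottom[of "\<not> s" X] top[of "\<not> s" X]
    by (simp_all add: right left bottom top)
qed

text \<open>Each equation is a braid relation between bent diagrams, that is, Reidemeister III with
  three equal signs. The opposite Booleans compensate for the quarter turn in sums.\<close>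

lemma twist_braid:
  "right_twist s (bottom_twist (\<not> s) (right_twist s X)) =
   bottom_twist (\<not> s) (right_twist s (bottom_twist (\<not> s) X))"
  "left_twist s (bottom_twist (\<not> s) (left_twist s X)) =
   bottom_twist (\<not> s) (left_twist s (bottom_twist (\<not> s) X))"
  "right_twist s (top_twist (\<not> s) (right_twist s X)) =
   top_twist (\<not> s) (right_twist s (top_twist (\<not> s) X))"
proof -
  show "right_twist s (bottom_twist (\<not> s) (right_twist s X)) =
    bottom_twist (\<not> s) (right_twist s (bottom_twist (\<not> s) X))"
  proof (transfer, drule isotopic_valid)
    fix s T assume T: "tangle_diagram T"
    note b = bent_apart_ops(1)[OF bent_apart_ops(3)[OF bent_apart_ops(1)[OF bent_self(1)[OF T]]]]
      bent_apart_ops(3)[OF bent_apart_ops(1)[OF bent_apart_ops(3)[OF bent_self(1)[OF T]]]]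
    show "add_right s (mult_bottom (\<not> s) (add_right s T)) \<sim>
      mult_bottom (\<not> s) (add_right s (mult_bottom (\<not> s) T))"
      by (rule bent_isotopic[OF b _ disjI1[OF refl]])
       (use slice_iso_sym[OF plat_braid[OF bend_valid(1)[OF T], of 1]] in simp)
  qed
  show "left_twist s (bottom_twist (\<not> s) (left_twist s X)) =
    bottom_twist (\<not> s) (left_twist s (bottom_twist (\<not> s) X))"
  proof (transfer, drule isotopic_valid)
    fix s T assume T: "tangle_diagram T"
    note b = bent_apart_ops(2)[OF bent_apart_ops(3)[OF bent_apart_ops(2)[OF bent_self(1)[OF T]]]]
      bent_apart_ops(3)[OF bent_apart_ops(2)[OF bent_apart_ops(3)[OF bent_self(1)[OF T]]]]
    show "add_left s (mult_bottom (\<not> s) (add_left s T)) \<sim>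
      mult_bottom (\<not> s) (add_left s (mult_bottom (\<not> s) T))"
      by (rule bent_isotopic[OF b _ disjI1[OF refl]])
       (use plat_braid[OF bend_valid(1)[OF T], of 0] in simp)
  qed
  show "right_twist s (top_twist (\<not> s) (right_twist s X)) =
    top_twist (\<not> s) (right_twist s (top_twist (\<not> s) X))"
  proof (transfer, drule isotopic_valid)
    fix s T assume T: "tangle_diagram T"
    note b = bent_right_ops(1)[OF bent_right_ops(3)[OF bent_right_ops(1)[OF bent_self(2)[OF T]]]]
      bent_right_ops(3)[OF bent_right_ops(1)[OF bent_right_ops(3)[OF bent_self(2)[OF T]]]]
    show "add_right s (mult_top (\<not> s) (add_right s T)) \<sim>
      mult_top (\<not> s) (add_right s (mult_top (\<not> s) T))"
      by (rule bent_isotopic[OF b _ disjI2[OF refl]])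
       (use plat_braid[OF bend_valid(2)[OF T], of 1] in simp)
  qed
qed

lemma right_left_commute: "right_twist s (left_twist t X) = left_twist t (right_twist s X)"
proof (transfer, drule isotopic_valid)
  fix s t T assume T: "tangle_diagram T"
  show "add_right s (add_left t T) \<sim> add_left t (add_right s T)"
    by (rule bent_isotopic[OF bent_apart_ops(1)[OF bent_apart_ops(2)[OF bent_self(1)[OF T]]]
          bent_apart_ops(2)[OF bent_apart_ops(1)[OF bent_self(1)[OF T]]] _ disjI1[OF refl]])
      (use plat_commute[OF bend_valid(1)[OF T]] in simp)
qed

lemma bottom_top_commute: "bottom_twist s (top_twist t X) = top_twist t (bottom_twist s X)"
  by transfer (auto simp: tangle_product_def
      dest!: isotopic_valid intro!: isotopic_refl tangle_diagram_ops[unfolded tangle_product_def])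

section \<open>Twists of the elementary tangles\<close>

lemma bent_infinity: "bent bend_apart infinity_tangle [(0, Cap), (2, Cap)]"
  using bent_self(1)[OF tangle_diagram_elementary(2)] by (simp add: bend_apart_def infinity_tangle_def)

text \<open>The bend at NE forms a zigzag with the lower arc's neighbour in \<open>[0]\<close>;
  straightening it leaves two nested maxima, in contrast to the adjacent ones of
  \<open>[\<infinity>]\<close>.\<close>

lemma bent_zero: "bent bend_apart zero_tangle [(0, Cap), (1, Cap)]"
  using slice_iso_local[OF zigzag_right[of 1], of 0 "[(0, Cap)]" "[(1, Cap)]" 4] tangle_diagram_elementary
  by (simp add: bent_def bend_apart_def zero_tangle_def)

lemma caps_swap: "slice_iso 0 4 [(0, Cap), (2, Cap)] [(0, Cap), (0, Cap)]"
  using slice_iso_local[OF exchange[of 0 0 Cap Cap], of 0 "[]" "[]" 4] by simp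

lemma twist_infinity [simp]:
  "right_twist s infinity = infinity" "left_twist s infinity = infinity"
  "top_twist s infinity = bottom_twist s infinity"
proof -
  have "slice_iso 0 4 [(0, Cap), (2, Cap), (2, Cross t)] [(0, Cap), (2, Cap)]" for t
    using slice_iso_local[OF R1_Cap[of 2 t], of 0 "[(0, Cap)]" "[]" 4] by simp
  then show "right_twist s infinity = infinity"
    by transfer (rule bent_isotopic[OF bent_apart_ops(1)[OF bent_infinity] bent_infinity _ disjI1[OF refl]], simp)
  have "slice_iso 0 4 [(0, Cap), (2, Cap), (0, Cross t)] [(0, Cap), (2, Cap)]" for t
  proof -
    have "slice_iso 0 4 [(0, Cap), (2, Cap), (0, Cross t)] [(0, Cap), (0, Cap), (0, Cross t)]"
      using slice_iso_local[OF exchange[of 0 0 Cap Cap], of 0 "[]" "[(0, Cross t)]" 4] by simp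
    also have "slice_iso 0 4 \<dots> [(0, Cap), (0, Cap)]"
      using slice_iso_local[OF R1_Cap[of 0 t], of 0 "[(0, Cap)]" "[]" 4] by simp
    also note slice_iso_sym[OF caps_swap]
    finally show ?thesis .
  qed
  then show "left_twist s infinity = infinity"
    by transfer (rule bent_isotopic[OF bent_apart_ops(2)[OF bent_infinity] bent_infinity _ disjI1[OF refl]], simp)
  show "top_twist s infinity = bottom_twist s infinity"
    by transfer (use isotopic_refl[OF tangle_diagram_ops(3)[OF tangle_diagram_elementary(2)]] in
        \<open>simp add: tangle_product_def infinity_tangle_def\<close>)
qed

lemma twist_zero [simp]: "bottom_twist s zero = zero" "top_twist s zero = zero"
proof -
  have "slice_iso 2 2 [(0, Cup), (0, Cap), (0, Cross t)] [(0, Cup), (0, Cap)]" for t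
    using slice_iso_local[OF R1_Cap[of 0 t], of 2 "[(0, Cup)]" "[]" 2] by simp
  then show "bottom_twist s zero = zero"
    by transfer (simp add: isotopic_iff_iso tangle_ops zero_tangle_def)
  have "slice_iso 2 2 [(0, Cross t), (0, Cup), (0, Cap)] [(0, Cup), (0, Cap)]" for t
    using slice_iso_local[OF R1_Cup[of 0 t], of 2 "[]" "[(0, Cap)]" 2] by simp
  then show "top_twist s zero = zero"
    by transfer (simp add: isotopic_iff_iso tangle_ops zero_tangle_def)
qed

text \<open>The first crossing slides through a maximum, which turns adjacent maxima into nested
  ones or conversely; its rotated form cancels against the second crossing.\<close>

lemma caps_twists:
  "slice_iso 0 4 [(0, Cap), (2, Cap), (1, Cross s), (2, Cross s)] [(0, Cap), (1, Cap)]"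
  "slice_iso 0 4 [(0, Cap), (2, Cap), (1, Cross s), (0, Cross s)] [(0, Cap), (1, Cap)]"
  "slice_iso 0 4 [(0, Cap), (1, Cap), (2, Cross s), (1, Cross s)] [(0, Cap), (2, Cap)]"
  "slice_iso 0 4 [(0, Cap), (1, Cap), (0, Cross s), (1, Cross s)] [(0, Cap), (2, Cap)]"
proof -
  have "slice_iso 0 4 [(0, Cap), (2, Cap), (1, Cross s), (2, Cross s)]
      [(0, Cap), (1, Cap), (2, Cross (\<not> s)), (2, Cross s)]"
    using slice_iso_local[OF slide_Cap[of 1 "\<not> s"], of 0 "[(0, Cap)]" "[(2, Cross s)]" 4, THEN slice_iso_sym] by simp
  also have "slice_iso 0 4 \<dots> [(0, Cap), (1, Cap)]"
    using plat_cancel[of "[(0, Cap), (1, Cap)]" 2 "\<not> s"] by simp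
  finally show "slice_iso 0 4 [(0, Cap), (2, Cap), (1, Cross s), (2, Cross s)] [(0, Cap), (1, Cap)]" .
  have "slice_iso 0 4 [(0, Cap), (2, Cap), (1, Cross s), (0, Cross s)] [(0, Cap), (0, Cap), (1, Cross s), (0, Cross s)]"
    using slice_iso_local[OF exchange[of 0 0 Cap Cap], of 0 "[]" "[(1, Cross s), (0, Cross s)]" 4] by simp
  also have "slice_iso 0 4 \<dots> [(0, Cap), (1, Cap), (0, Cross (\<not> s)), (0, Cross s)]"
    using slice_iso_local[OF slide_Cap[of 0 s], of 0 "[(0, Cap)]" "[(0, Cross s)]" 4] by simp
  also have "slice_iso 0 4 \<dots> [(0, Cap), (1, Cap)]"
    using plat_cancel[of "[(0, Cap), (1, Cap)]" 0 "\<not> s"] by simp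
  finally show "slice_iso 0 4 [(0, Cap), (2, Cap), (1, Cross s), (0, Cross s)] [(0, Cap), (1, Cap)]" .
  have "slice_iso 0 4 [(0, Cap), (1, Cap), (2, Cross s), (1, Cross s)] [(0, Cap), (2, Cap), (1, Cross (\<not> s)), (1, Cross s)]"
    using slice_iso_local[OF slide_Cap[of 1 s], of 0 "[(0, Cap)]" "[(1, Cross s)]" 4] by simp
  also have "slice_iso 0 4 \<dots> [(0, Cap), (2, Cap)]"
    using plat_cancel[of "[(0, Cap), (2, Cap)]" 1 "\<not> s"] by simp
  finally show "slice_iso 0 4 [(0, Cap), (1, Cap), (2, Cross s), (1, Cross s)] [(0, Cap), (2, Cap)]" .
  have "slice_iso 0 4 [(0, Cap), (1, Cap), (0, Cross s), (1, Cross s)] [(0, Cap), (0, Cap), (1, Cross (\<not> s)), (1, Cross s)]"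
    using slice_iso_local[OF slide_Cap[of 0 "\<not> s"], of 0 "[(0, Cap)]" "[(1, Cross s)]" 4, THEN slice_iso_sym] by simp
  also have "slice_iso 0 4 \<dots> [(0, Cap), (0, Cap)]"
    using plat_cancel[of "[(0, Cap), (0, Cap)]" 1 "\<not> s"] by simp
  also note slice_iso_sym[OF caps_swap]
  finally show "slice_iso 0 4 [(0, Cap), (1, Cap), (0, Cross s), (1, Cross s)] [(0, Cap), (2, Cap)]" .
qed

lemma twist_exchange:
  "right_twist s (bottom_twist (\<not> s) infinity) = zero"
  "left_twist s (bottom_twist (\<not> s) infinity) = zero"
  "bottom_twist (\<not> s) (right_twist s zero) = infinity"
  "bottom_twist (\<not> s) (left_twist s zero) = infinity"
proof -
  note i = bent_infinity and z = bent_zero and r = bent_apart_ops(1) and l = bent_apart_ops(2)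
    and b = bent_apart_ops(3) and e = disjI1[OF refl]
  show "right_twist s (bottom_twist (\<not> s) infinity) = zero"
    by transfer (rule bent_isotopic[OF r[OF b[OF i]] z _ e], simp add: caps_twists[simplified])
  show "left_twist s (bottom_twist (\<not> s) infinity) = zero"
    by transfer (rule bent_isotopic[OF l[OF b[OF i]] z _ e], simp add: caps_twists[simplified])
  show "bottom_twist (\<not> s) (right_twist s zero) = infinity"
    by transfer (rule bent_isotopic[OF b[OF r[OF z]] i _ e], simp add: caps_twists[simplified])
  show "bottom_twist (\<not> s) (left_twist s zero) = infinity"
    by transfer (rule bent_isotopic[OF b[OF l[OF z]] i _ e], simp add: caps_twists[simplified])
qed

section \<open>The kernel of \<open>B\<^sub>4 \<rightarrow> B\<^sub>3\<close>\<close>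

text \<open>\<open>x\<close>, \<open>y\<close>, \<open>z\<close> play the part of the generators
  \<open>\<sigma>\<^sub>1\<close>, \<open>\<sigma>\<^sub>2\<close>, \<open>\<sigma>\<^sub>3\<close>
  of \<open>B\<^sub>4\<close>. The abstraction serves both ways of bending, which make different
  twists the generators.\<close>

locale braid_action =
  fixes x x' y y' z z' :: "'a \<Rightarrow> 'a"
  assumes inverse [simp]: "x (x' p) = p" "x' (x p) = p" "y (y' p) = p" "y' (y p) = p"
      "z (z' p) = p" "z' (z p) = p"
    and xy: "x (y (x p)) = y (x (y p))"
    and zy: "z (y (z p)) = y (z (y p))"
    and xz: "x (z p) = z (x p)"
begin

text \<open>Invariance under the generators \<open>\<nu> = z x\<inverse>\<close> and \<open>\<mu> = y \<nu> y\<inverse>\<close> of the kernel. That the kernel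
  is normal is expressed by \<open>z\<inverse> \<mu> z = \<mu> \<nu>\<close> and \<open>y\<inverse> \<nu> y = \<nu> \<mu>\<inverse> \<nu>\<close>, which are \<open>conjugate_z\<close>
  and \<open>conjugate_y\<close> below.\<close>

definition fixed :: "'a \<Rightarrow> bool" where
  "fixed p \<longleftrightarrow> z p = x p \<and> y (z (x' (y' p))) = p"

lemma inverse_commute: "x' (z p) = z (x' p)"
  by (metis inverse xz)

lemma inverse_braid:
  "x' (y' (x' p)) = y' (x' (y' p))" "z' (y (z p)) = y (z (y' p))" "x' (y (x p)) = y (x (y' p))"
  "x (y' (x' p)) = y' (x' (y p))" "z' (y' (z p)) = y (z' (y' p))"
proof -
  show "z' (y (z p)) = y (z (y' p))" "x' (y (x p)) = y (x (y' p))" by (metis inverse xy zy)+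
  show "x (y' (x' p)) = y' (x' (y p))" by (metis inverse xy)
  show "z' (y' (z p)) = y (z' (y' p))" by (metis inverse zy)
  show "x' (y' (x' p)) = y' (x' (y' p))" by (metis inverse xy)
qed

text \<open>Prefixing \<open>z'\<close> turns \<open>z' y z\<close> into \<open>y z y'\<close>, and
  then \<open>y' x' y'\<close> becomes \<open>x' y' x'\<close>.\<close>

lemma conjugate_z: "y (z (x' (y' (z p)))) = z (y (z (x' (y' (z (x' p))))))"
proof -
  have "z' (y (z (x' (y' (z p))))) = y (z (y' (x' (y' (z p)))))"
    by (rule inverse_braid)
  also have "\<dots> = y (z (x' (y' (z (x' p)))))"
    by (simp only: inverse_braid(1)[symmetric] inverse_commute)
  finally show ?thesis by (metis inverse(5))
qed

text \<open>The right-hand side contracts to \<open>y z y x z' y' x'\<close>; the braid relation for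
  \<open>y\<close>, \<open>z\<close> removes \<open>z'\<close>, and \<open>y x y' x'\<close> is
  \<open>x' y\<close>.\<close>

lemma conjugate_y: "z (x' (y p)) = y (z (x' (y (x (z' (y' (z (x' p))))))))"
proof -
  have "y (z (x' (y (x (z' (y' (z (x' p)))))))) = y (z (y (x (z' (y' (x' p))))))"
    by (simp add: inverse_braid)
  also have "\<dots> = z (y (x (y' (x' p))))"
    by (simp flip: zy xz)
  also have "\<dots> = z (x' (y p))"
    by (simp add: inverse_braid)
  finally show ?thesis by simp
qed

lemma fixed_inverse:
  assumes "fixed p" shows "z (x' p) = p" "x (z' p) = p" "y (x (z' (y' p))) = p"
proof -
  have eq: "z p = x p" "y (z (x' (y' p))) = p" using assms by (simp_all add: fixed_def)
  show "z (x' p) = p" by (metis eq(1) inverse(2) inverse_commute)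
  show "x (z' p) = p" by (metis eq(1) inverse(1,2,5,6) inverse_commute)
  show "y (x (z' (y' p))) = p" by (metis eq(2) inverse(1,3,4,6) xz)
qed

lemma fixedI: "z (x' p) = p \<Longrightarrow> y (z (x' (y' p))) = p \<Longrightarrow> fixed p"
  unfolding fixed_def by (metis inverse(1) inverse_commute)

lemma fixed_z:
  assumes "fixed p" shows "fixed (z p)"
proof (rule fixedI)
  show "z (x' (z p)) = z p" using fixed_inverse(1)[OF assms] by (simp add: inverse_commute)
  show "y (z (x' (y' (z p)))) = z p"
    using conjugate_z[of p] fixed_inverse(1)[OF assms] assms by (simp add: fixed_def)
qed

lemma fixed_z':
  assumes "fixed p" shows "fixed (z' p)"
proof -
  have nu: "z (x' (z' p)) = z' p"
    using fixed_inverse(1)[OF assms] by (metis inverse(6) inverse_commute)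
  \<comment> \<open>The instance at \<open>z' p\<close>, which \<nu> is known to fix; as \<mu> fixes
    \<open>p\<close>, it reads \<open>p = z \<mu> z' p\<close>.\<close>
  have "y (z (x' (y' (z (z' p))))) = z (y (z (x' (y' (z (x' (z' p)))))))"
    by (rule conjugate_z)
  then have "p = z (y (z (x' (y' (z' p)))))"
    using assms by (simp add: nu fixed_def)
  then have "z' p = y (z (x' (y' (z' p))))" by (metis inverse(6))
  with nu show ?thesis by (intro fixedI) simp_all
qed

text \<open>Besides normality this uses \<open>\<mu> y = y \<nu>\<close>.\<close>

lemma fixed_y:
  assumes "fixed p" shows "fixed (y p)"
proof (rule fixedI)
  show "z (x' (y p)) = y p"
    using conjugate_y[of p] fixed_inverse[OF assms] by (simp add: inverse_commute)
  show "y (z (x' (y' (y p)))) = y p"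
    using fixed_inverse(1)[OF assms] by simp
qed

lemma fixed_y':
  assumes "fixed p" shows "fixed (y' p)"
proof -
  note eq = fixed_inverse[OF assms]
  have mu: "y (z (x' (y' p))) = p" using assms by (simp add: fixed_def)
  then have nu: "z (x' (y' p)) = y' p" by (metis inverse(4))
  \<comment> \<open>The instance at \<open>y' p\<close>, whose left side is \<nu> p, that is, p.
    Since \<nu> fixes \<open>y' p\<close>, one factor \<nu> disappears; applying \<mu>\<inverse> to
    both sides removes the other.\<close>
  have "p = y (z (x' (y (x (z' (y' (y' p)))))))"
    using conjugate_y[of "y' p"] by (simp add: nu eq)
  then have "y (x (z' (y' p))) = y (y (x (z' (y' (y' p)))))"
    by (metis inverse)
  then have "y' p = y (x (z' (y' (y' p))))"
    by (metis eq(3) inverse(4))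
  then have "y (z (x' (y' (y' p)))) = y' p"
    by (metis inverse)
  with nu show ?thesis by (intro fixedI) simp_all
qed

end

section \<open>Rational tangles and their continued fraction form\<close>

text \<open>The orbit of \<open>[\<infinity>]\<close> under \<open>B\<^sub>3\<close>; that left and
  top twists stay inside it will follow from the flypes.\<close>

inductive rational :: "tangle \<Rightarrow> bool" where
  rational_infinity: "rational infinity"
| rational_right: "rational X \<Longrightarrow> rational (right_twist s X)"
| rational_bottom: "rational X \<Longrightarrow> rational (bottom_twist s X)"

lemma bottom_twist_infinity: "bottom_twist s infinity = right_twist s zero"
  "bottom_twist s infinity = left_twist s zero"
  using twist_exchange(3,4)[of s] twist_inverse(5) by metis+

lemma rational_zero: "rational zero"
  using twist_exchange(1) rational.intros by metis

text \<open>In both braid actions \<open>y\<close> and \<open>z\<close> are the right and bottom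
  twists, in exchanged roles, while \<open>x\<close> is the left or the top twist. The points fixed
  by the kernel include \<open>[\<infinity>]\<close> and are closed under \<open>y\<close> and
  \<open>z\<close>, and the condition \<open>z p = x p\<close> is the flype.\<close>

lemma flype:
  assumes "rational X"
  shows "left_twist s X = right_twist s X" "top_twist s X = bottom_twist s X"
proof -
  note inverse = twist_inverse[where s = True, simplified]
  interpret l: braid_action "left_twist True" "left_twist False" "bottom_twist False"
    "bottom_twist True" "right_twist True" "right_twist False"
    by unfold_locales
      (use inverse twist_braid[of True] right_left_commute in simp_all)
  interpret t: braid_action "top_twist False" "top_twist True" "right_twist True"
    "right_twist False" "bottom_twist False" "bottom_twist True"
    by unfold_locales
      (use inverse twist_braid[of True] bottom_top_commute in simp_all)
  from assms have "l.fixed X \<and> t.fixed X"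
  proof induction
    case rational_infinity
    \<comment> \<open>The one condition at \<open>[\<infinity>]\<close> that is not immediate:
      \<open>[+1]\<close> is at once a left twist of \<open>[0]\<close>, a right twist of
      \<open>[0]\<close> and a bottom twist of \<open>[\<infinity>]\<close>.\<close>
    have "bottom_twist False (right_twist True (left_twist False (bottom_twist True infinity))) = infinity"
      by (metis bottom_twist_infinity inverse)
    then show ?case by (simp add: l.fixed_def t.fixed_def)
  next
    case (rational_right X s)
    then show ?case by (cases s) (auto intro: l.fixed_z l.fixed_z' t.fixed_y t.fixed_y')
  next
    case (rational_bottom X s)
    then show ?case by (cases s) (auto intro: l.fixed_y l.fixed_y' t.fixed_z t.fixed_z')
  qed
  then have "left_twist True X = right_twist True X" "left_twist False X = right_twist False X"
    "top_twist True X = bottom_twist True X" "top_twist False X = bottom_twist False X"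
    using l.fixed_inverse[of X] t.fixed_inverse[of X] inverse
    by (metis l.fixed_def t.fixed_def)+
  then show "left_twist s X = right_twist s X" "top_twist s X = bottom_twist s X"
    by (cases s; simp)+
qed

text \<open>A rational number other than \<open>0\<close> is reached from \<open>0\<close> by a unique sequence of these steps
  (the Euclidean algorithm, with all crossings of the same sign).\<close>

inductive canon :: "rat \<Rightarrow> tangle \<Rightarrow> bool" where
  canon_zero: "canon 0 zero"
| canon_right: "canon r X \<Longrightarrow> 0 \<le> crossing_sign s * r \<Longrightarrow>
    canon (r + crossing_sign s) (right_twist s X)"
| canon_bottom: "canon r X \<Longrightarrow> 0 < crossing_sign s * r \<Longrightarrow>
    canon (r / (1 + crossing_sign s * r)) (bottom_twist s X)"

lemma crossing_sign_simps [simp]: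
  "crossing_sign True = 1" "crossing_sign False = - 1"
  by (simp_all add: crossing_sign_def)

lemma crossing_sign_Not: "crossing_sign (\<not> s) = - crossing_sign s"
  by (cases s) simp_all

text \<open>The value reveals the last rule and its sign: the modulus is at least 1 after
  \<open>canon_right\<close> and strictly between 0 and 1 after \<open>canon_bottom\<close>.\<close>

lemma canon_rule_range:
  "0 \<le> crossing_sign s * r \<Longrightarrow> 1 \<le> crossing_sign s * (r + crossing_sign s)"
  "0 < crossing_sign s * r \<Longrightarrow> 0 < crossing_sign s * (r / (1 + crossing_sign s * r))"
  "0 < crossing_sign s * r \<Longrightarrow> crossing_sign s * (r / (1 + crossing_sign s * r)) < 1"
  by (cases s; simp add: field_simps)+

lemma bottom_step_inject:
  assumes "0 < crossing_sign s * r" "0 < crossing_sign s * q"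
    "r / (1 + crossing_sign s * r) = q / (1 + crossing_sign s * q)"
  shows "r = q"
  using assms by (cases s) (auto simp: field_simps)

lemma sign_exclusive:
  "0 < crossing_sign s * r \<Longrightarrow> 0 < crossing_sign t * r \<Longrightarrow> s = t"
  by (cases s; cases t) simp_all

text \<open>The value determines the last rule, its sign and the preceding value, as in Euclid's
  algorithm.\<close>

lemma canon_unique: "canon r X \<Longrightarrow> canon r Y \<Longrightarrow> X = Y"
proof (induction r X arbitrary: Y rule: canon.induct)
  case canon_zero
  from canon_zero show ?case
    by cases (use canon_rule_range in \<open>fastforce simp: mult_eq_0_iff\<close>)+
next
  case (canon_right r X s)
  from canon_right.prems show ?case
  proof cases
    case canon_zero
    with canon_rule_range(1)[OF canon_right.hyps(2)] show ?thesis by simp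
  next
    case (canon_right q Z t)
    have "s = t"
      using sign_exclusive[of s "r + crossing_sign s" t] canon_rule_range(1)[OF canon_right.hyps(2)]
        canon_rule_range(1)[OF canon_right(4)] canon_right(1) by simp
    with canon_right canon_right.IH show ?thesis by simp
  next
    case (canon_bottom q Z t)
    then show ?thesis
      using sign_exclusive[of s "r + crossing_sign s" t] canon_rule_range(1)[OF canon_right.hyps(2)]
        canon_rule_range(2,3)[OF canon_bottom(4)] by fastforce
  qed
next
  case (canon_bottom r X s)
  from canon_bottom.prems show ?case
  proof cases
    case canon_zero
    with canon_rule_range(2)[OF canon_bottom.hyps(2)] show ?thesis by simp
  next
    case (canon_right q Z t)
    then show ?thesis
      using sign_exclusive[of s "q + crossing_sign t" t] canon_rule_range(2,3)[OF canon_bottom.hyps(2)]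
        canon_rule_range(1)[OF canon_right(4)] by fastforce
  next
    case (canon_bottom q Z t)
    have "s = t"
      using sign_exclusive[of s "r / (1 + crossing_sign s * r)" t] canon_rule_range(2)[OF canon_bottom.hyps(2)]
        canon_rule_range(2)[OF canon_bottom(4)] canon_bottom(1) by simp
    moreover from this have "r = q"
      using bottom_step_inject[of s r q] canon_bottom.hyps canon_bottom(1,4) by simp
    ultimately show ?thesis using canon_bottom canon_bottom.IH by simp
  qed
qed

section \<open>The half twist, and closure of the continued fraction form under twists\<close>

text \<open>The half twist \<open>\<Delta>\<close>; the two signs give it and its inverse.\<close>

definition rotation :: "bool \<Rightarrow> tangle \<Rightarrow> tangle" where
  "rotation s X = right_twist s (bottom_twist (\<not> s) (right_twist s X))"

text \<open>The generators of the half twist are a right and a bottom twist of opposite Booleans,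
  hence the negation. One sign is the braid relation, the other follows by inverting.\<close>

lemma rotation_twist:
  "rotation s (right_twist t X) = bottom_twist (\<not> t) (rotation s X)"
  "rotation s (bottom_twist t X) = right_twist (\<not> t) (rotation s X)"
proof -
  have r: "rotation s (right_twist s X) = bottom_twist (\<not> s) (rotation s X)" for X
    by (simp add: rotation_def flip: twist_braid)
  have b: "rotation s (bottom_twist (\<not> s) X) = right_twist s (rotation s X)" for X
    by (simp add: rotation_def twist_braid)
  have r': "rotation s (right_twist (\<not> s) X) = bottom_twist s (rotation s X)"
    using r[of "right_twist (\<not> s) X"] by simp
  have b': "rotation s (bottom_twist s X) = right_twist (\<not> s) (rotation s X)"
    using b[of "bottom_twist s X"] by simp
  show "rotation s (right_twist t X) = bottom_twist (\<not> t) (rotation s X)"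
    by (cases "t = s") (use r r' in auto)
  show "rotation s (bottom_twist t X) = right_twist (\<not> t) (rotation s X)"
    by (cases "t = s") (use b b' in auto)
qed

lemma rotation_zero: "rotation s zero = infinity"
  by (simp add: rotation_def twist_exchange)

text \<open>The map \<open>r \<mapsto> - 1 / r\<close> takes steps of one kind to steps of the other
  kind with opposite sign, so a derivation is translated step by step.\<close>

lemma canon_rotation: "canon r X \<Longrightarrow> r \<noteq> 0 \<Longrightarrow> canon (- 1 / r) (rotation u X)"
proof (induction r X rule: canon.induct)
  case (canon_right r X s)
  show ?case
  proof (cases "r = 0")
    \<comment> \<open>The first step starts at \<open>[0]\<close>, which rotates to
      \<open>[\<infinity>]\<close>; but a bottom twist of \<open>[\<infinity>]\<close> is again a
      first step from \<open>[0]\<close>.\<close>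
    case True
    with canon_right canon_zero canon_unique have "X = zero" by blast
    then have "rotation u (right_twist s X) = right_twist (\<not> s) zero"
      by (simp add: rotation_twist rotation_zero bottom_twist_infinity)
    with canon.canon_right[OF canon_zero, of "\<not> s"] True show ?thesis by (cases s) simp_all
  next
    case False
    then have "0 < crossing_sign (\<not> s) * (- 1 / r)"
      using canon_right.hyps(2) by (cases s) (simp_all add: field_simps)
    from canon_bottom[OF canon_right.IH[OF False] this]
    have "canon (- 1 / r / (1 + crossing_sign (\<not> s) * (- 1 / r))) (rotation u (right_twist s X))"
      by (simp add: rotation_twist)
    moreover have "- 1 / r / (1 + crossing_sign (\<not> s) * (- 1 / r)) = - 1 / (r + crossing_sign s)"
      using False canon_right.hyps(2) by (cases s) (auto simp: field_simps)
    ultimately show ?thesis by simp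
  qed
next
  case (canon_bottom r X s)
  then have "r \<noteq> 0" by auto
  have "0 \<le> crossing_sign (\<not> s) * (- 1 / r)"
    using canon_bottom.hyps(2) by (cases s) (simp_all add: field_simps)
  from canon_right[OF canon_bottom.IH[OF \<open>r \<noteq> 0\<close>] this]
  have "canon (- 1 / r + crossing_sign (\<not> s)) (rotation u (bottom_twist s X))"
    by (simp only: rotation_twist)
  moreover have "- 1 / r + crossing_sign (\<not> s) = - 1 / (r / (1 + crossing_sign s * r))"
    using \<open>r \<noteq> 0\<close> by (cases s) (auto simp: field_simps)
  ultimately show ?case by simp
qed simp

text \<open>A twist whose sign opposes \<open>r\<close> either cancels the last step or meets a
  bottom step; the half twist deals with the latter.\<close>

lemma canon_right_closed:
  assumes "canon r X"
  shows "canon (r + crossing_sign s) (right_twist s X)"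
proof (cases "0 \<le> crossing_sign s * r")
  case True
  with assms show ?thesis by (rule canon_right)
next
  case False
  from assms show ?thesis
  proof cases
    case canon_zero
    with False show ?thesis by simp
  next
    case (canon_right q Z t)
    with False canon_rule_range(1)[OF canon_right(4)] have "t = (\<not> s)"
      by (cases s; cases t) auto
    with canon_right show ?thesis by (simp add: crossing_sign_Not)
  next
    case (canon_bottom q Z t)
    with False canon_rule_range(2)[OF canon_bottom(4)] have t: "t = (\<not> s)"
      by (cases s; cases t) auto
    with canon_bottom(4) have q: "q \<noteq> 0" "0 < crossing_sign s * (- 1 / q)"
      by (auto simp: crossing_sign_Not field_simps zero_less_mult_iff)
    \<comment> \<open>\<open>Z\<close> is replaced by
      \<open>right_twist s (right_twist (\<not> s) Z)\<close> to complete a half twist.\<close>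
    have "right_twist s X = rotation s (right_twist (\<not> s) Z)"
      by (simp add: rotation_def canon_bottom t)
    also have "\<dots> = bottom_twist s (rotation s Z)"
      by (simp add: rotation_twist)
    also have "canon (- 1 / q / (1 + crossing_sign s * (- 1 / q))) \<dots>"
      by (rule canon.canon_bottom[OF canon_rotation]) (use canon_bottom q in simp_all)
    also have "- 1 / q / (1 + crossing_sign s * (- 1 / q)) = r + crossing_sign s"
      using q canon_bottom(4) unfolding canon_bottom(1) t by (cases s) (auto simp: field_simps)
    finally show ?thesis .
  qed
qed

text \<open>The exceptional case is the pole of the fractional linear map; the others follow the
  pattern of right twists.\<close>

lemma canon_bottom_closed:
  assumes "canon r X"
  shows "if 1 + crossing_sign s * r = 0 then bottom_twist s X = infinity
    else canon (r / (1 + crossing_sign s * r)) (bottom_twist s X)"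
proof (cases "0 < crossing_sign s * r")
  case True
  with assms show ?thesis using canon_bottom by auto
next
  case False
  from assms show ?thesis
  proof cases
    case canon_zero
    then show ?thesis using canon.canon_zero by simp
  next
    case (canon_right q Z t)
    with False canon_rule_range(1)[OF canon_right(4)] have t: "t = (\<not> s)"
      by (cases s; cases t) auto
    show ?thesis
    proof (cases "q = 0")
      case True
      with canon_right canon.canon_zero canon_unique have "Z = zero" by blast
      then show ?thesis
        using canon_right t True twist_exchange(3)[of "\<not> s"] by (cases s) simp_all
    next
      case q: False
      \<comment> \<open>\<open>Z\<close> is replaced by
        \<open>bottom_twist s (bottom_twist (\<not> s) Z)\<close>, and the braid relation yields the
        half twist of sign \<open>\<not> s\<close>.\<close>
      have "bottom_twist s X = rotation (\<not> s) (bottom_twist (\<not> s) Z)"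
        using twist_braid(1)[of "\<not> s"] by (simp add: rotation_def canon_right t)
      also have "\<dots> = right_twist s (rotation (\<not> s) Z)"
        by (simp add: rotation_twist)
      also have "canon (- 1 / q + crossing_sign s) \<dots>"
        by (rule canon_right_closed[OF canon_rotation]) (use canon_right q in simp_all)
      also have "- 1 / q + crossing_sign s = r / (1 + crossing_sign s * r)"
        using q unfolding canon_right(1) t by (cases s) (auto simp: field_simps)
      finally show ?thesis
        using q unfolding canon_right(1) t by (cases s) auto
    qed
  next
    case (canon_bottom q Z t)
    with False canon_rule_range(2)[OF canon_bottom(4)] have t: "t = (\<not> s)"
      by (cases s; cases t) auto
    have "r / (1 + crossing_sign s * r) = q" "1 + crossing_sign s * r \<noteq> 0"
      using canon_bottom(4) unfolding canon_bottom(1) t by (cases s; auto simp: field_simps)+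
    with canon_bottom t show ?thesis by simp
  qed
qed

fun has_canon :: "ext_rat \<Rightarrow> tangle \<Rightarrow> bool" where
  "has_canon None X \<longleftrightarrow> X = infinity"
| "has_canon (Some r) X \<longleftrightarrow> canon r X"

lemma has_canon_unique: "has_canon p X \<Longrightarrow> has_canon p Y \<Longrightarrow> X = Y"
  by (cases p) (auto intro: canon_unique)

lemma has_canon_right: "has_canon p X \<Longrightarrow> has_canon (ext_add p (crossing_sign s)) (right_twist s X)"
  by (cases p) (auto simp: ext_add_def canon_right_closed)

lemma has_canon_bottom:
  assumes "has_canon p X"
  shows "has_canon (ext_inverse (ext_add (ext_inverse p) (crossing_sign s))) (bottom_twist s X)"
proof (cases p)
  case None
  with assms canon_right[OF canon_zero, of s] show ?thesis
    by (cases s) (simp_all add: ext_add_def bottom_twist_infinity)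
next
  case (Some r)
  with assms canon_bottom_closed[of r X s] canon_zero show ?thesis
    by (cases s; cases "r = 0") (auto simp: ext_add_def field_simps split: if_splits)
qed

section \<open>Twist forms in the quotient\<close>

primrec twist_tangle :: "twist_form \<Rightarrow> tangle" where
  "twist_tangle Zero = zero"
| "twist_tangle Infinity = infinity"
| "twist_tangle (Add_Right t b) = right_twist b (twist_tangle t)"
| "twist_tangle (Add_Left b t) = left_twist b (twist_tangle t)"
| "twist_tangle (Mult_Bottom t b) = bottom_twist b (twist_tangle t)"
| "twist_tangle (Mult_Top b t) = top_twist b (twist_tangle t)"

lemma tangle_diagram_twist: "tangle_diagram (twist_diagram t)"
  by (induction t) (simp_all add: tangle_diagram_elementary tangle_diagram_ops)

lemma abs_twist_diagram: "abs_tangle (twist_diagram t) = twist_tangle t"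
  by (induction t)
    (simp_all add: zero_def infinity_def
      right_twist.abs_eq[OF isotopic_refl[OF tangle_diagram_twist], symmetric]
      left_twist.abs_eq[OF isotopic_refl[OF tangle_diagram_twist], symmetric]
      bottom_twist.abs_eq[OF isotopic_refl[OF tangle_diagram_twist], symmetric]
      top_twist.abs_eq[OF isotopic_refl[OF tangle_diagram_twist], symmetric])

lemma twist_diagram_isotopic_iff:
  "twist_diagram t \<sim> twist_diagram s \<longleftrightarrow> twist_tangle t = twist_tangle s"
  using Quotient3_rel[OF Quotient3_tangle, of "twist_diagram t" "twist_diagram s"]
  by (simp add: abs_twist_diagram isotopic_refl tangle_diagram_twist)

lemma rational_twist_tangle: "rational (twist_tangle t)"
  by (induction t) (auto intro: rational.intros rational_zero simp: flype)

lemma has_canon_twist: "has_canon (twist_fraction t) (twist_tangle t)"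
  by (induction t)
    (simp_all add: canon_zero has_canon_right has_canon_bottom flype rational_twist_tangle)

lemma equal_fraction_isotopic:
  "twist_fraction t = twist_fraction s \<Longrightarrow> twist_diagram t \<sim> twist_diagram s"
  unfolding twist_diagram_isotopic_iff using has_canon_twist has_canon_unique by metis

section \<open>Colourings\<close>

text \<open>The strands carry colours \<open>f 0, f 1, \<dots>\<close>, as if infinitely many vertical strands were added on
  the right; then no side conditions on the number of strands are needed.\<close>

fun colours_match :: "feature \<Rightarrow> rat \<Rightarrow> rat \<Rightarrow> rat \<Rightarrow> rat \<Rightarrow> bool" where
  "colours_match Cap a b c d \<longleftrightarrow> c = d"
| "colours_match Cup a b c d \<longleftrightarrow> a = b"
| "colours_match (Cross s) a b c d \<longleftrightarrow> (if s then d = a \<and> c = 2 * a - b else c = b \<and> d = 2 * b - a)"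

definition slice_coloured :: "nat \<Rightarrow> feature \<Rightarrow> (nat \<Rightarrow> rat) \<Rightarrow> (nat \<Rightarrow> rat) \<Rightarrow> bool" where
  "slice_coloured i s f g \<longleftrightarrow> (\<forall>k<i. g k = f k) \<and>
     (\<forall>k. g (i + strands_below s + k) = f (i + strands_above s + k)) \<and>
     colours_match s (f i) (f (i + 1)) (g i) (g (i + 1))"

fun coloured :: "diagram \<Rightarrow> (nat \<Rightarrow> rat) \<Rightarrow> (nat \<Rightarrow> rat) \<Rightarrow> bool" where
  "coloured [] f g \<longleftrightarrow> g = f"
| "coloured ((i, s) # D) f g \<longleftrightarrow> (\<exists>h. slice_coloured i s f h \<and> coloured D h g)"

text \<open>Reflection in a horizontal line, which swaps the colours above and below a slice and so
  reduces one direction of an exchange to the other.\<close>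

fun turn :: "feature \<Rightarrow> feature" where
  "turn Cap = Cup"
| "turn Cup = Cap"
| "turn (Cross s) = Cross (\<not> s)"

lemma turn_strands [simp]: "strands_above (turn s) = strands_below s"
  "strands_below (turn s) = strands_above s" "turn (turn s) = s"
  by (cases s; simp)+

lemma slice_coloured_turn: "slice_coloured i (turn s) g f \<longleftrightarrow> slice_coloured i s f g"
proof -
  have "colours_match (turn s) c d a b \<longleftrightarrow> colours_match s a b c d" for a b c d
    by (cases s) auto
  then show ?thesis by (auto simp: slice_coloured_def)
qed

lemma slices_exchange:
  assumes "i \<le> j" "slice_coloured i s f h" "slice_coloured (j + strands_below s) t h g"
  shows "\<exists>h. slice_coloured (j + strands_above s) t f h \<and> slice_coloured i s h g"
proof -
  \<comment> \<open>The colours between the exchanged slices: those of the top up to the place of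
    \<open>t\<close>, and from there on those of the bottom, reindexed because \<open>s\<close> has
    not yet acted. The subtraction is never truncated.\<close>
  define h' where "h' k = (if k < j + strands_above s then f k
    else g (k - strands_above s + strands_below s))" for k
  have h1: "h k = f k" if "k < i" for k
    using assms(2) that by (simp add: slice_coloured_def)
  have h2: "h (i + strands_below s + k) = f (i + strands_above s + k)" for k
    using assms(2) by (simp add: slice_coloured_def)
  have h3: "h (j + strands_below s + k) = f (j + strands_above s + k)" for k
    using h2[of "j - i + k"] assms(1) by (simp add: ac_simps)
  have g1: "g k = h k" if "k < j + strands_below s" for k
    using assms(3) that by (simp add: slice_coloured_def)
  have g2: "g (j + strands_below s + strands_below t + k) = h (j + strands_below s + strands_above t + k)" for k
    using assms(3) by (simp add: slice_coloured_def)
  have "slice_coloured (j + strands_above s) t f h'"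
  proof -
    have "h' (j + strands_above s + strands_below t + k) = f (j + strands_above s + strands_above t + k)" for k
    proof -
      have "h' (j + strands_above s + strands_below t + k) = g (j + strands_below s + strands_below t + k)"
        by (simp add: h'_def add.commute add.left_commute)
      also have "\<dots> = f (j + strands_above s + strands_above t + k)"
        using g2 h3[of "strands_above t + k"] by (simp add: add.assoc)
      finally show ?thesis .
    qed
    moreover have "colours_match t (f (j + strands_above s)) (f (j + strands_above s + 1))
      (h' (j + strands_above s)) (h' (j + strands_above s + 1))"
    proof -
      have "h' (j + strands_above s) = g (j + strands_below s)"
        "h' (j + strands_above s + 1) = g (j + strands_below s + 1)"
        by (simp_all add: h'_def)
      then show ?thesis
        using assms(3) h3[of 0] h3[of 1] by (simp add: slice_coloured_def)
    qed
    ultimately show ?thesis by (simp add: slice_coloured_def h'_def)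
  qed
  moreover have "slice_coloured i s h' g"
  proof -
    have "g (i + strands_below s + k) = h' (i + strands_above s + k)" for k
      using h2[of k] g1[of "i + strands_below s + k"] by (auto simp: h'_def ac_simps)
    moreover have "colours_match s (h' i) (h' (i + 1)) (g i) (g (i + 1))"
      using assms g1 by (cases s) (auto simp: slice_coloured_def h'_def)
    ultimately show ?thesis
      using assms(1) h1 g1 by (auto simp: slice_coloured_def h'_def)
  qed
  ultimately show ?thesis by blast
qed

text \<open>Colours below a slice as functions of those above, so that colourings become equations;
  only a maximum has a free parameter, the colour \<open>y\<close>.\<close>

definition colour_cap :: "nat \<Rightarrow> rat \<Rightarrow> (nat \<Rightarrow> rat) \<Rightarrow> nat \<Rightarrow> rat" where
  "colour_cap i y f k = (if k < i then f k else if k < i + 2 then y else f (k - 2))"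

definition colour_cup :: "nat \<Rightarrow> (nat \<Rightarrow> rat) \<Rightarrow> nat \<Rightarrow> rat" where
  "colour_cup i f k = (if k < i then f k else f (k + 2))"

definition colour_cross :: "bool \<Rightarrow> nat \<Rightarrow> (nat \<Rightarrow> rat) \<Rightarrow> nat \<Rightarrow> rat" where
  "colour_cross s i f k =
    (if k = i then (if s then 2 * f i - f (i + 1) else f (i + 1))
     else if k = i + 1 then (if s then f i else 2 * f (i + 1) - f i) else f k)"

lemmas colour_defs = colour_cap_def colour_cup_def colour_cross_def

lemma slice_coloured_Cap: "slice_coloured i Cap f g \<longleftrightarrow> (\<exists>y. g = colour_cap i y f)"
proof
  assume "slice_coloured i Cap f g"
  then have g: "\<And>k. k < i \<Longrightarrow> g k = f k" "\<And>k. g (i + 2 + k) = f (i + k)" "g (i + 1) = g i"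
    by (simp_all add: slice_coloured_def)
  have "g k = colour_cap i (g i) f k" for k
  proof -
    consider "k < i" | "k = i" | "k = i + 1" | "i + 2 \<le> k" by linarith
    then show ?thesis
    proof cases
      case 4
      then obtain m where "k = i + 2 + m" using le_Suc_ex by blast
      then show ?thesis using g(2)[of m] by (simp add: colour_cap_def)
    qed (simp_all add: colour_cap_def g(1) g(3)[simplified])
  qed
  then show "\<exists>y. g = colour_cap i y f" by blast
next
  assume "\<exists>y. g = colour_cap i y f"
  then show "slice_coloured i Cap f g"
    by (auto simp: slice_coloured_def colour_cap_def)
qed

lemma slice_coloured_Cup: "slice_coloured i Cup f g \<longleftrightarrow> f i = f (i + 1) \<and> g = colour_cup i f"
proof
  assume "slice_coloured i Cup f g"
  then have g: "\<And>k. k < i \<Longrightarrow> g k = f k" "\<And>k. g (i + k) = f (i + 2 + k)" "f i = f (i + 1)"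
    by (simp_all add: slice_coloured_def)
  have "g k = colour_cup i f k" for k
  proof (cases "k < i")
    case False
    then obtain m where "k = i + m" using le_Suc_ex not_less by blast
    then show ?thesis using g(2)[of m] by (simp add: colour_cup_def add.commute add.left_commute)
  qed (simp add: colour_cup_def g(1))
  with g(3) show "f i = f (i + 1) \<and> g = colour_cup i f" by blast
next
  assume "f i = f (i + 1) \<and> g = colour_cup i f"
  then show "slice_coloured i Cup f g"
    by (simp add: slice_coloured_def colour_cup_def add.commute add.left_commute)
qed

lemma slice_coloured_Cross: "slice_coloured i (Cross s) f g \<longleftrightarrow> g = colour_cross s i f"
proof
  assume "slice_coloured i (Cross s) f g"
  then have g: "\<And>k. k < i \<Longrightarrow> g k = f k" "\<And>k. g (i + 2 + k) = f (i + 2 + k)"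
    "g i = colour_cross s i f i" "g (i + 1) = colour_cross s i f (i + 1)"
    by (simp_all add: slice_coloured_def colour_cross_def split: if_splits)
  have "g k = colour_cross s i f k" for k
  proof -
    consider "k < i" | "k = i" | "k = i + 1" | "i + 2 \<le> k" by linarith
    then show ?thesis
    proof cases
      case 4
      then obtain m where "k = i + 2 + m" using le_Suc_ex by blast
      then show ?thesis using g(2)[of m] by (simp add: colour_cross_def)
    qed (simp_all add: colour_cross_def g(1) g(3,4)[unfolded colour_cross_def, simplified])
  qed
  then show "g = colour_cross s i f" by blast
next
  assume "g = colour_cross s i f"
  then show "slice_coloured i (Cross s) f g"
    by (simp add: slice_coloured_def colour_cross_def)
qed

lemmas slice_coloured_simps = slice_coloured_Cap slice_coloured_Cup slice_coloured_Cross

section \<open>Invariance of colourings under the local moves\<close>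

lemma ex_image_conj:
  "(\<exists>h. (\<exists>y. h = F y) \<and> P h) \<longleftrightarrow> (\<exists>y. P (F y))"
  "(\<exists>h. (A \<and> h = t) \<and> P h) \<longleftrightarrow> A \<and> P t"
  by auto

lemma colour_zigzag:
  "colour_cup (i + 1) (colour_cap i (f i) f) = f"
  "colour_cup i (colour_cap (i + 1) (f i) f) = f"
  by (auto simp: colour_defs less_Suc_eq)

lemma colour_R1:
  "colour_cross b i (colour_cap i y f) = colour_cap i y f"
  "f i = f (i + 1) \<Longrightarrow> colour_cross b i f = f"
  by (auto simp: colour_defs less_Suc_eq)

text \<open>If the vertical strand crosses over, the top of the bent arc moves to the other side of
  it, which reflects the free colour in \<open>f i\<close>.\<close>

lemma colour_slide_Cap:
  "colour_cross b (i + 1) (colour_cap i y f) =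
    colour_cross (\<not> b) i (colour_cap (i + 1) (if b then y else 2 * f i - y) f)"
proof
  fix k
  have "k < i \<or> k = i \<or> k = i + 1 \<or> k = i + 2 \<or> k > i + 2" by auto
  then show "colour_cross b (i + 1) (colour_cap i y f) k =
    colour_cross (\<not> b) i (colour_cap (i + 1) (if b then y else 2 * f i - y) f) k"
    by (auto simp: colour_defs)
qed

lemma colour_R2: "colour_cross (\<not> b) i (colour_cross b i f) = f"
  by (auto simp: colour_cross_def)

lemma colour_R3:
  assumes "b = a \<or> b = c"
  shows "colour_cross c i (colour_cross b (i + 1) (colour_cross a i f)) =
    colour_cross a (i + 1) (colour_cross b i (colour_cross c (i + 1) f))"
proof
  fix k
  consider "k = i" | "k = i + 1" | "k = i + 2" | "k \<noteq> i" "k \<noteq> i + 1" "k \<noteq> i + 2" by blast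
  then show "colour_cross c i (colour_cross b (i + 1) (colour_cross a i f)) k =
    colour_cross a (i + 1) (colour_cross b i (colour_cross c (i + 1) f)) k"
    using assms by cases (cases a; cases b; cases c; simp add: colour_cross_def)+
qed

lemma coloured_local_move: "local_move D E \<Longrightarrow> coloured D f g \<longleftrightarrow> coloured E f g"
proof (induction rule: local_move.induct)
  case (exchange i j s t)
  have "\<exists>h. slice_coloured i s f h \<and> slice_coloured (j + strands_below s) t h g"
    if "slice_coloured (j + strands_above s) t f h" "slice_coloured i s h g" for h
    using slices_exchange[OF exchange, of "turn s" g h "turn t" f] that
    by (auto simp: slice_coloured_turn)
  with slices_exchange[OF exchange] show ?case by auto
next
  case (zigzag_left i)
  have "colour_cap i y f (i + 1) = colour_cap i y f (i + 1 + 1) \<longleftrightarrow> y = f i" for y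
    by (simp add: colour_cap_def)
  with colour_zigzag(1)[of i f] show ?case
    by (auto simp: slice_coloured_simps ex_image_conj)
next
  case (zigzag_right i)
  have "colour_cap (i + 1) y f i = colour_cap (i + 1) y f (i + 1) \<longleftrightarrow> y = f i" for y
    by (auto simp add: colour_cap_def)
  with colour_zigzag(2)[of i f] show ?case
    by (auto simp: slice_coloured_simps ex_image_conj)
next
  case (slide_Cap i b)
  have "(\<exists>y. g = colour_cross b (i + 1) (colour_cap i y f)) \<longleftrightarrow>
    (\<exists>y. g = colour_cross (\<not> b) i (colour_cap (i + 1) y f))" (is "_ \<longleftrightarrow> (\<exists>y. g = ?F y)")
  proof
    assume "\<exists>y. g = ?F y"
    then obtain y where "g = ?F y" ..
    \<comment> \<open>The change of the free colour is an involution, so both sides allow the same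
      colourings.\<close>
    moreover have "?F y = ?F (if b then z else 2 * f i - z)" if "z = (if b then y else 2 * f i - y)" for z
      using that by simp
    ultimately show "\<exists>y. g = colour_cross b (i + 1) (colour_cap i y f)"
      unfolding colour_slide_Cap by blast
  qed (use colour_slide_Cap in blast)
  then show ?case
    by (simp add: slice_coloured_simps ex_image_conj)
next
  case (slide_Cup i b)
  have "colour_cross b (i + 1) f i = colour_cross b (i + 1) f (i + 1) \<longleftrightarrow>
    colour_cross (\<not> b) i f (i + 1) = colour_cross (\<not> b) i f (i + 1 + 1)"
    by (auto simp: colour_cross_def)
  moreover have "colour_cup i (colour_cross b (i + 1) f) = colour_cup (i + 1) (colour_cross (\<not> b) i f)"
    if "colour_cross b (i + 1) f i = colour_cross b (i + 1) f (i + 1)"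
    using that by (auto simp: colour_defs less_Suc_eq)
  ultimately show ?case
    by (auto simp: slice_coloured_simps ex_image_conj)
next
  case (R1_Cap i b)
  show ?case
    by (simp add: slice_coloured_simps ex_image_conj colour_R1)
next
  case (R1_Cup i b)
  have "colour_cross b i f i = colour_cross b i f (i + 1) \<longleftrightarrow> f i = f (i + 1)"
    by (auto simp: colour_cross_def)
  then show ?case
    using colour_R1(2)[of f i b] by (auto simp: slice_coloured_simps ex_image_conj)
next
  case (R2 i b)
  show ?case
    by (simp add: slice_coloured_simps colour_R2)
next
  case (R3 b a c i)
  then show ?case
    using colour_R3[of b a c i f] by (simp add: slice_coloured_simps)
qed

section \<open>The fraction is an invariant\<close>

lemma coloured_append: "coloured (U @ V) f g \<longleftrightarrow> (\<exists>h. coloured U f h \<and> coloured V h g)"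
  by (induction U f g rule: coloured.induct) auto

lemma isotopic_coloured:
  assumes "T \<sim> S"
  shows "coloured T f g \<longleftrightarrow> coloured S f g"
proof -
  have "tangle_move\<^sup>*\<^sup>* T S" using assms by (simp add: isotopic_def)
  then show ?thesis
  proof induction
    case (step S R)
    from step(2) have "coloured S f g \<longleftrightarrow> coloured R f g"
    proof cases
      case (1 D E U V)
      then have "coloured D f g \<longleftrightarrow> coloured E f g" for f g
        using coloured_local_move[of D E] coloured_local_move[of E D] by blast
      with 1 show ?thesis by (simp add: coloured_append)
    qed
    with step(3) show ?case by simp
  qed simp
qed

fun slope :: "ext_rat \<Rightarrow> rat \<Rightarrow> rat \<Rightarrow> bool" where
  "slope None u v \<longleftrightarrow> v = 0"
| "slope (Some r) u v \<longleftrightarrow> u = r * v"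

lemma slope_add: "slope (ext_add p r) u v \<longleftrightarrow> slope p (u - r * v) v"
  by (cases p) (auto simp: ext_add_def algebra_simps)

lemma slope_inverse: "slope (ext_inverse p) u v \<longleftrightarrow> slope p v u"
  by (cases p) (auto simp: field_simps)

lemma slope_inject:
  assumes "\<And>u v. slope p u v \<longleftrightarrow> slope q u v" shows "p = q"
proof (cases p)
  case None
  with assms[of 1 0] have "slope q 1 0" by simp
  with None show ?thesis by (cases q) simp_all
next
  case (Some r)
  with assms[of r 1] have "slope q r 1" by simp
  with Some show ?thesis by (cases q) simp_all
qed

text \<open>\<open>f 0\<close>, \<open>f 1\<close> are the colours at NW, NE and \<open>g 0\<close>,
  \<open>g 1\<close> those at SW, SE; the strands from 2 on stand outside the tangle.\<close>

definition twist_coloured :: "ext_rat \<Rightarrow> (nat \<Rightarrow> rat) \<Rightarrow> (nat \<Rightarrow> rat) \<Rightarrow> bool" where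
  "twist_coloured p f g \<longleftrightarrow> (\<forall>k\<ge>2. g k = f k) \<and> f 0 + g 1 = f 1 + g 0 \<and>
     slope p (f 1 - f 0) (f 0 - g 0)"

text \<open>The crossing leaves \<open>f 1 - f 0\<close> alone and adds it, up to sign, to
  \<open>f 0 - g 0\<close>, so the inverse of the fraction changes by \<plusminus>1.\<close>

lemma coloured_mult_bottom:
  assumes "\<And>f g. coloured T f g \<longleftrightarrow> twist_coloured p f g"
  shows "coloured (mult_bottom s T) f g \<longleftrightarrow>
    twist_coloured (ext_inverse (ext_add (ext_inverse p) (crossing_sign s))) f g"
proof -
  have inv: "colour_cross s 0 h = g \<longleftrightarrow> h = colour_cross (\<not> s) 0 g" for h
    by (metis colour_R2 not_not)
  \<comment> \<open>Crossings act invertibly on colours, so \<open>h\<close> is the only candidate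
    between \<open>T\<close> and the crossing.\<close>
  define h where "h = colour_cross (\<not> s) 0 g"
  have "coloured (mult_bottom s T) f g \<longleftrightarrow> (\<exists>h. twist_coloured p f h \<and> g = colour_cross s 0 h)"
    by (simp add: tangle_ops coloured_append assms slice_coloured_Cross)
  also have "\<dots> \<longleftrightarrow> twist_coloured p f h"
    unfolding h_def by (metis inv)
  also have "\<dots> \<longleftrightarrow> twist_coloured (ext_inverse (ext_add (ext_inverse p) (crossing_sign s))) f g"
  proof -
    have "h k = g k" if "k \<ge> 2" for k
      using that by (simp add: h_def colour_cross_def)
    moreover have "f 0 + h 1 = f 1 + h 0 \<longleftrightarrow> f 0 + g 1 = f 1 + g 0"
      by (cases s) (simp_all add: h_def colour_cross_def, linarith+)
    moreover have "f 0 - h 0 = f 0 - g 0 - crossing_sign s * (f 1 - f 0)" if "f 0 + g 1 = f 1 + g 0"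
      using that by (cases s) (simp_all add: h_def colour_cross_def)
    ultimately show ?thesis
      unfolding twist_coloured_def slope_inverse slope_add by (metis (no_types, lifting))
  qed
  finally show ?thesis .
qed

text \<open>Now \<open>f 0 - g 0\<close> is kept, and the top difference \<open>y - f 0\<close> of
  \<open>T\<close> differs from \<open>f 1 - f 0\<close> by \<plusminus> that amount, where
  \<open>y\<close> is the colour of the maximum joining \<open>T\<close> to the crossing.\<close>

lemma coloured_add_right:
  assumes "\<And>f g. coloured T f g \<longleftrightarrow> twist_coloured p f g"
  shows "coloured (add_right s T) f g \<longleftrightarrow> twist_coloured (ext_add p (crossing_sign s)) f g"
proof -
  let ?ok = "\<lambda>y h. twist_coloured p (colour_cap 1 y f) h \<and>
    colour_cross s 2 h 1 = colour_cross s 2 h 2 \<and> g = colour_cup 1 (colour_cross s 2 h)"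
  have "coloured (add_right s T) f g \<longleftrightarrow> (\<exists>y h. ?ok y h)"
    by (simp add: tangle_ops coloured_append assms slice_coloured_simps)
       auto
  also have "\<dots> \<longleftrightarrow> twist_coloured (ext_add p (crossing_sign s)) f g"
  proof
    assume "\<exists>y h. ?ok y h"
    then obtain y h where h: "?ok y h" by blast
    then have hk: "h 2 = y" "h 3 = f 1" "\<And>k. k \<ge> 2 \<Longrightarrow> h (k + 2) = f k"
      by (auto simp: twist_coloured_def colour_cap_def)
    have y: "f 0 + h 1 = y + h 0" "slope p (y - f 0) (f 0 - h 0)"
      using h by (auto simp: twist_coloured_def colour_cap_def)
    have g: "g 0 = h 0" "g 1 = (if s then y else 2 * f 1 - y)" "\<And>k. k \<ge> 2 \<Longrightarrow> g k = f k"
      "h 1 = (if s then 2 * y - f 1 else f 1)"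
      using h hk by (auto simp: colour_cup_def colour_cross_def)
    have eq: "f 0 + g 1 = f 1 + g 0" using y(1) g by (auto split: if_splits)
    then have "f 1 - f 0 - crossing_sign s * (f 0 - g 0) = y - f 0"
      using g by (auto split: if_splits)
    with y(2) g(1) have "slope p (f 1 - f 0 - crossing_sign s * (f 0 - g 0)) (f 0 - g 0)"
      by (simp only:)
    with g(3) eq show "twist_coloured (ext_add p (crossing_sign s)) f g"
      by (simp add: twist_coloured_def slope_add)
  next
    assume g: "twist_coloured (ext_add p (crossing_sign s)) f g"
    \<comment> \<open>For \<open>s\<close> the arc from the maximum crosses over and ends at SE;
      otherwise it passes under the strand coloured \<open>f 1\<close>.\<close>
    define y where "y = (if s then g 1 else 2 * f 1 - g 1)"
    \<comment> \<open>\<open>h 1\<close> is the colour at the lower left of the crossing, as the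
      minimum of the sum requires.\<close>
    define h where "h k = (if k = 0 then g 0 else if k = 1 then (if s then 2 * y - f 1 else f 1)
      else colour_cap 1 y f k)" for k
    have eq: "f 0 + g 1 = f 1 + g 0" using g by (simp add: twist_coloured_def)
    then have "f 1 - f 0 - crossing_sign s * (f 0 - g 0) = y - f 0"
      by (auto simp: y_def)
    moreover have "slope p (f 1 - f 0 - crossing_sign s * (f 0 - g 0)) (f 0 - g 0)"
      using g by (simp only: twist_coloured_def slope_add)
    ultimately have "slope p (y - f 0) (f 0 - g 0)" by (simp only:)
    moreover have "f 0 + h 1 = y + h 0"
      using eq by (auto simp: h_def y_def)
    ultimately have "twist_coloured p (colour_cap 1 y f) h"
      by (simp add: twist_coloured_def h_def colour_cap_def)
    moreover have "colour_cross s 2 h 1 = colour_cross s 2 h 2"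
      by (simp add: colour_cross_def h_def colour_cap_def)
    moreover have "g = colour_cup 1 (colour_cross s 2 h)"
    proof
      fix k :: nat
      consider "k = 0" | "k = 1" | "k \<ge> 2" by linarith
      then show "g k = colour_cup 1 (colour_cross s 2 h) k"
        by cases (use g in \<open>auto simp: colour_cup_def colour_cross_def h_def y_def colour_cap_def
          twist_coloured_def\<close>)
    qed
    ultimately show "\<exists>y h. ?ok y h" by blast
  qed
  finally show ?thesis .
qed

lemma coloured_twist_diagram: "coloured (twist_diagram t) f g \<longleftrightarrow> twist_coloured (twist_fraction t) f g"
proof (induction t arbitrary: f g)
  case Zero
  have two: "Suc (Suc (k - 2)) = k" if "2 \<le> k" for k using that by simp
  show ?case
  proof
    assume "coloured (twist_diagram Zero) f g"
    then show "twist_coloured (twist_fraction Zero) f g"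
      by (auto simp: zero_tangle_def slice_coloured_simps twist_coloured_def colour_defs two)
  next
    assume g: "twist_coloured (twist_fraction Zero) f g"
    have "g k = colour_cap 0 (g 0) (colour_cup 0 f) k" for k
    proof -
      consider "k = 0" | "k = 1" | "k \<ge> 2" by linarith
      then show ?thesis
        by cases (use g in \<open>auto simp: twist_coloured_def colour_defs two\<close>)
    qed
    then have "\<exists>y. g = colour_cap 0 y (colour_cup 0 f)" by blast
    with g show "coloured (twist_diagram Zero) f g"
      by (auto simp: zero_tangle_def slice_coloured_simps twist_coloured_def)
  qed
next
  case Infinity
  show ?case
  proof
    assume g: "twist_coloured (twist_fraction Infinity) f g"
    have "g k = f k" for k
    proof -
      consider "k = 0" | "k = 1" | "k \<ge> 2" by linarith
      then show ?thesis
        by cases (use g in \<open>auto simp: twist_coloured_def\<close>)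
    qed
    then show "coloured (twist_diagram Infinity) f g" by (auto simp: infinity_tangle_def)
  qed (auto simp: infinity_tangle_def twist_coloured_def)
next
  case (Add_Right t s)
  then show ?case by (simp add: coloured_add_right)
next
  case (Add_Left s t)
  \<comment> \<open>A flype reduces the left summand to the right summand; the top factor is treated
    likewise.\<close>
  have "twist_diagram (Add_Left s t) \<sim> twist_diagram (Add_Right t s)"
    by (simp only: twist_diagram_isotopic_iff) (simp add: flype rational_twist_tangle)
  from isotopic_coloured[OF this] Add_Left show ?case by (simp add: coloured_add_right)
next
  case (Mult_Bottom t s)
  then show ?case by (simp add: coloured_mult_bottom)
next
  case (Mult_Top s t)
  have "twist_diagram (Mult_Top s t) \<sim> twist_diagram (Mult_Bottom t s)"
    by (simp only: twist_diagram_isotopic_iff) (simp add: flype rational_twist_tangle)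
  from isotopic_coloured[OF this] Mult_Top show ?case by (simp add: coloured_mult_bottom)
qed

lemma isotopic_equal_fraction:
  assumes "twist_diagram t \<sim> twist_diagram s"
  shows "twist_fraction t = twist_fraction s"
proof (rule slope_inject)
  fix u v
  \<comment> \<open>The corner colours 0, \<open>u\<close>, \<open>- v\<close>, \<open>u - v\<close>
    have the differences \<open>u\<close> and \<open>v\<close>, so every pair is tested.\<close>
  define f :: "nat \<Rightarrow> rat" where "f = (\<lambda>_. 0)(1 := u)"
  define g :: "nat \<Rightarrow> rat" where "g = (\<lambda>_. 0)(0 := - v, 1 := u - v)"
  have "twist_coloured (twist_fraction t) f g \<longleftrightarrow> twist_coloured (twist_fraction s) f g"
    using isotopic_coloured[OF assms, of f g] by (simp only: coloured_twist_diagram)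
  then show "slope (twist_fraction t) u v \<longleftrightarrow> slope (twist_fraction s) u v"
    by (simp add: twist_coloured_def f_def g_def)
qed

theorem theorem1:
  fixes T S :: diagram and p q :: "rat option"
  assumes "rational_tangle T" and "rational_tangle S"
    and "has_fraction T p" and "has_fraction S q"
  shows "T \<sim> S \<longleftrightarrow> p = q"
proof -
  obtain t s where t: "T \<sim> twist_diagram t" "twist_fraction t = p"
    and s: "S \<sim> twist_diagram s" "twist_fraction s = q"
    using assms(3,4) by (auto simp: has_fraction_def)
  have "T \<sim> S \<longleftrightarrow> twist_diagram t \<sim> twist_diagram s"
    by (meson t(1) s(1) isotopic_sym isotopic_trans)
  also have "\<dots> \<longleftrightarrow> twist_fraction t = twist_fraction s"
    by (auto intro: equal_fraction_isotopic isotopic_equal_fraction)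
  finally show ?thesis using t(2) s(2) by simp
qed

end
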